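(* Let $d\ge1$, $\sigma>0$, $r\ge0$, $n\in\mathbb{N}$, and set $b_{r,\sigma}:=\frac{r^2+4r}{\sigma^2}$. Define the function classes $$\mathcal{F}_{\varphi_\sigma}(b):=\{f*\varphi_\sigma:\ f:\mathbb{R}^d\to\mathbb{R}\text{ measurable},\ |f(x)|\le 0.5b(1+\|x\|)\ \forall x\},\qquad \mathcal{E}_{\varphi_\sigma}(b):=\{e^f*\varphi_\sigma:\ f:\mathbb{R}^d\to\mathbb{R}\text{ measurable},\ |f(x)|\le 0.5b(1+\|x\|)\ \forall x\}.$$ For $\mu,\nu\in\mathcal{P}(\mathbb{B}_d(r))$, let $X_1,\dots,X_n$ be i.i.d. $\sim\mu$, $Y_1,\dots,Y_n$ i.i.d. $\sim\nu$, $\hat\mu_n,\hat\nu_n$ the corresponding empirical measures, and $\varepsilon_1,\dots,\varepsilon_n$ i.i.d. Rademacher variables independent of $(X^n,Y^n)$. Set $$Z^{(\varepsilon)}_{n,\sigma}:=\mathbb{E}_\varepsilon\Big[\sup_{f\in\mathcal{F}_{\varphi_\sigma}(b_{r,\sigma})}\Big|\sum_{i=1}^n\varepsilon_if(X_i)\Big|\Big],\qquad \bar Z^{(\varepsilon)}_{n,\sigma}:=\mathbb{E}_\varepsilon\Big[\sup_{f\in\mathcal{E}_{\varphi_\sigma}(b_{r,\sigma})}\Big|\sum_{i=1}^n\varepsilon_if(Y_i)\Big|\Big].$$ Then for every $z\ge0$, $$\sup_{\mu,\nu\in\mathcal{P}(\mathbb{B}_d(r))}\mathbb{P}\Big(\big|\mathsf{D}_{\mathsf{KL}}(\hat\mu_n*\gamma_\sigma\|\hat\nu_n*\gamma_\sigma)-\mathsf{D}_{\mathsf{KL}}(\mu*\gamma_\sigma\|\nu*\gamma_\sigma)\big|\ge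 7n^{-1}\big(Z^{(\varepsilon)}_{n,\sigma}+\bar Z^{(\varepsilon)}_{n,\sigma}\big)+44\,\xi_{r,d,\sigma}z\Big)\le 2e^{-(nz^2\wedge nz)},$$ where $\xi_{r,d,\sigma}:=\exp\!\Big(\frac{(r^2+4r)(2dr^2+(8d+1)r+1)}{2\sigma^2}\Big)$.
   Context: $\gamma_\sigma=N(0,\sigma^2I_d)$ with Lebesgue density $\varphi_\sigma(x)=(2\pi\sigma^2)^{-d/2}e^{-\|x\|^2/(2\sigma^2)}$; $*$ is convolution. $\mathcal{P}(\mathbb{B}_d(r))$ is the set of Borel probability measures on $\mathbb{R}^d$ supported in the closed Euclidean ball of radius $r$. $\mathsf{D}_{\mathsf{KL}}(\mu\|\nu)=\int p_\mu\log(p_\mu/p_\nu)d\rho$ if $\mu\ll\nu$, $+\infty$ otherwise. $\mathbb{E}_\varepsilon$ denotes expectation with respect to the Rademacher variables only (conditionally on the samples). Rademacher: $\mathbb{P}(\varepsilon_i=1)=\mathbb{P}(\varepsilon_i=-1)=1/2$. *)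

theory Defs
  imports "HOL-Probability.Probability"
begin

definition gauss_dens :: "real \<Rightarrow> 'a::euclidean_space \<Rightarrow> real" where
  "gauss_dens \<sigma> x = (2 * pi * \<sigma>\<^sup>2) powr (- real DIM('a) / 2) * exp (- (norm x)\<^sup>2 / (2 * \<sigma>\<^sup>2))"

definition smooth_dens :: "real \<Rightarrow> 'a::euclidean_space measure \<Rightarrow> 'a \<Rightarrow> real" where
  "smooth_dens \<sigma> \<mu> y = (\<integral>x. gauss_dens \<sigma> (y - x) \<partial>\<mu>)"

definition conv_gauss :: "real \<Rightarrow> ('a::euclidean_space \<Rightarrow> real) \<Rightarrow> 'a \<Rightarrow> real" where
  "conv_gauss \<sigma> f x = (\<integral>y. f y * gauss_dens \<sigma> (x - y) \<partial>lborel)"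

text \<open>KL divergence between two measures given by their Lebesgue densities p, q
  (reference measure rho = Lebesgue): +infinity unless absolutely continuous;
  +infinity if the integral diverges (its negative part is always integrable for probability densities).\<close>
definition KL_lborel :: "('a::euclidean_space \<Rightarrow> real) \<Rightarrow> ('a \<Rightarrow> real) \<Rightarrow> ereal" where
  "KL_lborel p q =
     (if (AE x in lborel. q x = 0 \<longrightarrow> p x = 0)
         \<and> integrable lborel (\<lambda>x. p x * ln (p x / q x))
      then ereal (\<integral>x. p x * ln (p x / q x) \<partial>lborel)
      else \<infinity>)"

definition prob_ball :: "real \<Rightarrow> 'a::euclidean_space measure set" where
  "prob_ball r = {\<mu>. prob_space \<mu> \<and> sets \<mu> = sets borel \<and> emeasure \<mu> (cball 0 r) = 1}"

definition empirical :: "nat \<Rightarrow> (nat \<Rightarrow> 'a) \<Rightarrow> 'a measure" where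
  "empirical n X = measure_pmf (pmf_of_multiset (image_mset X (mset_set {..<n})))"

definition admissible :: "real \<Rightarrow> ('a::euclidean_space \<Rightarrow> real) \<Rightarrow> bool" where
  "admissible b f \<longleftrightarrow> f \<in> borel_measurable borel \<and> (\<forall>x. \<bar>f x\<bar> \<le> 0.5 * b * (1 + norm x))"

definition F_class :: "real \<Rightarrow> real \<Rightarrow> ('a::euclidean_space \<Rightarrow> real) set" where
  "F_class \<sigma> b = {conv_gauss \<sigma> f | f. admissible b f}"

definition E_class :: "real \<Rightarrow> real \<Rightarrow> ('a::euclidean_space \<Rightarrow> real) set" where
  "E_class \<sigma> b = {conv_gauss \<sigma> (\<lambda>x. exp (f x)) | f. admissible b f}"

definition rad_avg :: "nat \<Rightarrow> ('a \<Rightarrow> real) set \<Rightarrow> (nat \<Rightarrow> 'a) \<Rightarrow> ereal" where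
  "rad_avg n G X = ereal (1 / 2 ^ n) *
     (\<Sum>\<epsilon>\<in>PiE {..<n} (\<lambda>_. {-1::real, 1}). (SUP g\<in>G. ereal \<bar>\<Sum>i<n. \<epsilon> i * g (X i)\<bar>))"

definition b_const :: "real \<Rightarrow> real \<Rightarrow> real" where
  "b_const r \<sigma> = (r\<^sup>2 + 4 * r) / \<sigma>\<^sup>2"

definition xi_const :: "real \<Rightarrow> real \<Rightarrow> real \<Rightarrow> real" where
  "xi_const r d \<sigma> = exp ((r\<^sup>2 + 4 * r) * (2 * d * r\<^sup>2 + (8 * d + 1) * r + 1) / (2 * \<sigma>\<^sup>2))"

end

theory Submission
  imports Defs
begin

text \<open>
  For \<open>\<mu>, \<nu>\<close> in the ball of radius \<open>r\<close> the log-ratio of the smoothed densities is bounded by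
  \<open>b / 2 * (1 + norm y)\<close>, so by the Donsker--Varadhan formula the divergence error is at most the sum of
  the empirical deviations over the two function classes. Over functions \<open>k\<close> with \<open>lo \<le> k \<le> hi\<close>
  the supremum of \<open>\<bar>\<integral> k w\<bar>\<close> is attained at \<open>k = hi\<close> on \<open>w \<ge> 0\<close>, \<open>k = lo\<close> elsewhere (or the other
  way round); this turns all suprema into explicit integrals, which are measurable. The deviation minus
  twice the Rademacher average has nonpositive mean by symmetrization and bounded differences
  \<open>6 * C\<close>, where \<open>C = 2 * \<xi>\<close> bounds both smoothed classes on the ball, and Hoeffding's lemma applied
  coordinatewise gives a sub-Gaussian tail that is stronger than the one required.
\<close>

section \<open>Bounded differences\<close>

text \<open>The event of the theorem need not be measurable, since \<open>rad_avg\<close> contains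
  suprema over uncountable classes; hence the outer measure. Only lower bounds on
  \<open>rad_avg\<close> are required: evaluating it at an extremal \<open>k\<close> gives the
  measurable quantity \<open>rademacher\<close>, and putting this smaller quantity in its place
  enlarges the event to a measurable one. The constant \<open>b_const r \<sigma>\<close> is such
  that \<open>h y = b / 2 * (1 + norm y)\<close> dominates the log-ratio of any two Gaussian
  mixtures with centres in the ball, and \<open>2 * \<xi>\<close> bounds the integral of
  \<open>exp h\<close> against a Gaussian centred in the ball. Up to the substitution
  \<open>k = exp f\<close>, the two classes are the smoothed bands from \<open>- h\<close> to
  \<open>h\<close> and from \<open>exp (- h)\<close> to \<open>exp h\<close>; \<open>exp h\<close>
  majorizes both, so one abstract argument with \<open>lo\<close>, \<open>hi\<close>,
  \<open>H\<close> and \<open>C\<close> serves twice. Independence of the two samples multiplies two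
  exponential moments. With \<open>C = 2 * \<xi>\<close> the Chernoff exponent is
  \<open>- 44 * \<xi> * z * n * l + 144 * n * \<xi>^2 * l^2\<close>, nearly minimal at
  \<open>l = z / (6 * \<xi>)\<close>, where it equals \<open>- 10 / 3 * n * z^2\<close>.\<close>

text \<open>McDiarmid's argument at the level of exponential moments, by induction on the index set:
  integrating out coordinate \<open>j\<close> leaves the conditional mean \<open>g\<close>, which
  inherits both \<open>B\<close> and \<open>c\<close>, and costs one factor
  \<open>exp (l^2 * c^2 / 2)\<close>.\<close>

lemma (in prob_space) mgf_bounded_differences:
  fixes f :: "('i \<Rightarrow> 'a) \<Rightarrow> real"
  assumes "finite I" "f \<in> borel_measurable (PiM I (\<lambda>_. M))" "l > 0"
    and "\<And>X. X \<in> space (PiM I (\<lambda>_. M)) \<Longrightarrow> \<bar>f X\<bar> \<le> B"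
    and "\<And>X i x. X \<in> space (PiM I (\<lambda>_. M)) \<Longrightarrow> i \<in> I \<Longrightarrow> x \<in> space M \<Longrightarrow> \<bar>f (X(i := x)) - f X\<bar> \<le> c"
  shows "(\<integral>\<^sup>+X. ennreal (exp (l * f X)) \<partial>PiM I (\<lambda>_. M))
    \<le> ennreal (exp (l * (\<integral>X. f X \<partial>PiM I (\<lambda>_. M)) + real (card I) * l\<^sup>2 * c\<^sup>2 / 2))"
  using assms(1,2,4,5)
proof (induction I arbitrary: f)
  case empty
  then show ?case
    by (simp add: PiM_empty nn_integral_count_space_finite lebesgue_integral_count_space_finite)
next
  case (insert j I)
  note [measurable] = insert.prems(1)
  interpret P: product_sigma_finite "\<lambda>_. M"
    by (simp add: product_sigma_finite_def sigma_finite_measure_axioms)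
  interpret PI: prob_space "PiM I (\<lambda>_. M)"
    by (intro prob_space_PiM prob_space_axioms)
  interpret PI': prob_space "PiM (insert j I) (\<lambda>_. M)"
    by (intro prob_space_PiM prob_space_axioms)
  have upd: "X(j := x) \<in> space (PiM (insert j I) (\<lambda>_. M))"
    if "X \<in> space (PiM I (\<lambda>_. M))" "x \<in> space M" for X x
    using that by (auto simp: space_PiM PiE_iff extensional_def)
  define g where "g X = (\<integral>x. f (X(j := x)) \<partial>M)" for X
  have g_meas: "g \<in> borel_measurable (PiM I (\<lambda>_. M))"
    unfolding g_def by measurable
  have f_meas: "(\<lambda>x. f (X(j := x))) \<in> borel_measurable M" if "X \<in> space (PiM I (\<lambda>_. M))" for X
    using that by measurable
  have f_int: "integrable M (\<lambda>x. f (X(j := x)))" if "X \<in> space (PiM I (\<lambda>_. M))" for X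
    by (rule integrable_const_bound[where B = B]) (use that insert.prems(2) upd f_meas in auto)
  have diff: "\<bar>f (X(j := x)) - f (X(j := x'))\<bar> \<le> c"
    if "X \<in> space (PiM I (\<lambda>_. M))" "x \<in> space M" "x' \<in> space M" for X x x'
    using insert.prems(3)[OF upd[OF that(1,3)] insertI1 that(2)] unfolding fun_upd_upd .
  have abs_int_le: "\<bar>\<integral>x. h x \<partial>M\<bar> \<le> b"
    if "integrable M h" "\<And>x. x \<in> space M \<Longrightarrow> \<bar>h x\<bar> \<le> b" for h :: "'a \<Rightarrow> real" and b
  proof -
    have "\<bar>\<integral>x. h x \<partial>M\<bar> \<le> (\<integral>x. \<bar>h x\<bar> \<partial>M)" by simp
    also have "\<dots> \<le> (\<integral>x. b \<partial>M)"
      using that by (intro integral_mono) auto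
    finally show ?thesis by (simp add: prob_space)
  qed
  have near: "\<bar>f (X(j := x)) - g X\<bar> \<le> c" if "X \<in> space (PiM I (\<lambda>_. M))" "x \<in> space M" for X x
  proof -
    have "f (X(j := x)) - g X = (\<integral>x'. f (X(j := x)) - f (X(j := x')) \<partial>M)"
      using f_int[OF that(1)] by (simp add: g_def prob_space)
    also have "\<bar>\<dots>\<bar> \<le> c"
      by (rule abs_int_le) (use f_int that diff in auto)
    finally show ?thesis .
  qed
  have g_bound: "\<bar>g X\<bar> \<le> B" if "X \<in> space (PiM I (\<lambda>_. M))" for X
    unfolding g_def by (rule abs_int_le) (use f_int that upd insert.prems(2) in auto)
  have g_diff: "\<bar>g (X(i := x)) - g X\<bar> \<le> c"
    if "X \<in> space (PiM I (\<lambda>_. M))" "i \<in> I" "x \<in> space M" for X i x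
  proof -
    have X': "X(i := x) \<in> space (PiM I (\<lambda>_. M))"
      using that by (auto simp: space_PiM PiE_iff extensional_def)
    have "g (X(i := x)) - g X = (\<integral>y. f (X(i := x, j := y)) - f (X(j := y)) \<partial>M)"
      using f_int[OF that(1)] f_int[OF X'] by (simp add: g_def)
    also have "\<bar>\<dots>\<bar> \<le> c"
    proof (rule abs_int_le)
      fix y assume y: "y \<in> space M"
      have "i \<noteq> j" using that insert.hyps by auto
      then have "X(i := x, j := y) = X(j := y, i := x)" by (simp add: fun_upd_twist)
      then show "\<bar>f (X(i := x, j := y)) - f (X(j := y))\<bar> \<le> c"
        using insert.prems(3)[OF upd[OF that(1) y] insertI2[OF that(2)] that(3)] by metis
    qed (use f_int[OF that(1)] f_int[OF X'] in auto)
    finally show ?thesis .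
  qed
  have step: "(\<integral>\<^sup>+x. ennreal (exp (l * f (X(j := x)))) \<partial>M) \<le> ennreal (exp (l * g X) * exp (l\<^sup>2 * c\<^sup>2 / 2))"
    if X: "X \<in> space (PiM I (\<lambda>_. M))" for X
  proof -
    \<comment> \<open>The interval has length \<open>2 * c\<close>, so Hoeffding's exponent
      \<open>l^2 * (2 * c)^2 / 8\<close> becomes \<open>l^2 * c^2 / 2\<close>. Centring it at
      \<open>g X\<close> avoids infima and suprema over \<open>x\<close>, at the price of a factor 4
      against the sharp exponent.\<close>
    interpret iv: interval_bounded_random_variable M "\<lambda>x. f (X(j := x))" "g X - c" "g X + c"
      using near[OF X] by unfold_locales (use f_meas X in \<open>auto simp: abs_le_iff algebra_simps\<close>)
    have "(\<integral>\<^sup>+x. ennreal (exp (l * f (X(j := x)))) \<partial>M)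
        = (\<integral>\<^sup>+x. ennreal (exp (l * g X)) * ennreal (exp (l * (f (X(j := x)) - g X))) \<partial>M)"
      by (intro nn_integral_cong) (simp flip: ennreal_mult exp_add add: algebra_simps)
    also have "\<dots> = ennreal (exp (l * g X)) * (\<integral>\<^sup>+x. ennreal (exp (l * (f (X(j := x)) - g X))) \<partial>M)"
      using f_meas[OF X] by (intro nn_integral_cmult) measurable
    also have "\<dots> \<le> ennreal (exp (l * g X)) * ennreal (exp (l\<^sup>2 * ((g X + c) - (g X - c))\<^sup>2 / 8))"
      using iv.Hoeffdings_lemma_nn_integral[OF \<open>l > 0\<close>] unfolding g_def by (intro mult_left_mono) auto
    also have "\<dots> = ennreal (exp (l * g X) * exp (l\<^sup>2 * c\<^sup>2 / 2))"
      by (simp add: power2_eq_square flip: ennreal_mult)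
    finally show ?thesis .
  qed
  have "(\<integral>\<^sup>+X. ennreal (exp (l * f X)) \<partial>PiM (insert j I) (\<lambda>_. M))
     = (\<integral>\<^sup>+X. \<integral>\<^sup>+x. ennreal (exp (l * f (X(j := x)))) \<partial>M \<partial>PiM I (\<lambda>_. M))"
    using insert.hyps by (subst P.product_nn_integral_insert) auto
  also have "\<dots> \<le> (\<integral>\<^sup>+X. ennreal (exp (l\<^sup>2 * c\<^sup>2 / 2)) * ennreal (exp (l * g X)) \<partial>PiM I (\<lambda>_. M))"
    using step by (intro nn_integral_mono) (auto simp: mult.commute simp flip: ennreal_mult)
  also have "\<dots> = ennreal (exp (l\<^sup>2 * c\<^sup>2 / 2)) * (\<integral>\<^sup>+X. ennreal (exp (l * g X)) \<partial>PiM I (\<lambda>_. M))"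
    using g_meas by (intro nn_integral_cmult) measurable
  also have "\<dots> \<le> ennreal (exp (l\<^sup>2 * c\<^sup>2 / 2)) *
      ennreal (exp (l * (\<integral>X. g X \<partial>PiM I (\<lambda>_. M)) + real (card I) * l\<^sup>2 * c\<^sup>2 / 2))"
    by (intro mult_left_mono insert.IH g_meas g_bound g_diff) auto
  also have "\<dots> = ennreal (exp (l * (\<integral>X. g X \<partial>PiM I (\<lambda>_. M)) + real (card (insert j I)) * l\<^sup>2 * c\<^sup>2 / 2))"
    using insert.hyps by (simp flip: ennreal_mult exp_add add: algebra_simps add_divide_distrib)
  also have "(\<integral>X. g X \<partial>PiM I (\<lambda>_. M)) = (\<integral>X. f X \<partial>PiM (insert j I) (\<lambda>_. M))"
    unfolding g_def using insert.hyps insert.prems(2)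
    by (subst P.product_integral_insert)
       (auto intro!: PI'.integrable_const_bound[where B = B])
  finally show ?case .
qed

section \<open>Symmetrization\<close>

lemma sum_PiE_insert:
  assumes "finite I" "j \<notin> I"
  shows "(\<Sum>\<epsilon>\<in>PiE (insert j I) (\<lambda>_. S). f \<epsilon>) = (\<Sum>e\<in>S. \<Sum>\<epsilon>\<in>PiE I (\<lambda>_. S). f (\<epsilon>(j := e)))"
proof -
  have "(\<Sum>\<epsilon>\<in>PiE (insert j I) (\<lambda>_. S). f \<epsilon>) = (\<Sum>(e, \<epsilon>)\<in>S \<times> PiE I (\<lambda>_. S). f (\<epsilon>(j := e)))"
    unfolding PiE_insert_eq
    by (subst sum.reindex) (use inj_combinator[OF assms(2), of "\<lambda>_. S"] in \<open>auto simp: case_prod_unfold\<close>)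
  then show ?thesis by (simp add: sum.cartesian_product)
qed

section \<open>Suprema over a band of test functions\<close>

text \<open>Abstract form of smoothing: \<open>M\<close> is the law of one sample point,
  \<open>K x\<close> the density of the noise centred at \<open>x\<close>, and
  \<open>\<integral> k y * K x y\<close> over \<open>L\<close> the value at \<open>x\<close> of the
  smoothed test function \<open>k\<close>. The bound \<open>C\<close> is uniform in
  \<open>x\<close>, which later yields bounded differences.\<close>

locale sampled_kernel = prob_space M + L: sigma_finite_measure L
  for M :: "'a measure" and L :: "'b measure" +
  fixes K :: "'a \<Rightarrow> 'b \<Rightarrow> real" and lo hi H :: "'b \<Rightarrow> real" and C :: real
  assumes K_meas [measurable]: "case_prod K \<in> borel_measurable (M \<Otimes>\<^sub>M L)"
    and lo_meas [measurable]: "lo \<in> borel_measurable L"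
    and hi_meas [measurable]: "hi \<in> borel_measurable L"
    and H_meas [measurable]: "H \<in> borel_measurable L"
    and lo_hi: "lo y \<le> hi y" and lo_H: "\<bar>lo y\<bar> \<le> H y" and hi_H: "\<bar>hi y\<bar> \<le> H y"
    and K_nonneg: "0 \<le> K x y"
    and HK_int: "x \<in> space M \<Longrightarrow> integrable L (\<lambda>y. H y * K x y)"
    and HK_le: "x \<in> space M \<Longrightarrow> (\<integral>y. H y * K x y \<partial>L) \<le> C"
begin

sublocale KL: pair_sigma_finite M L by unfold_locales

definition mean :: "'b \<Rightarrow> real" where
  "mean y = (\<integral>x. K x y \<partial>M)"

text \<open>Integrability against the common majorant \<open>H\<close> makes the integral of
  \<open>k * w\<close> exist for all \<open>k\<close> in the band at once. Signed \<open>w\<close>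
  are allowed, so these functions form a vector space, which contains every \<open>K x\<close> and
  \<open>mean\<close>.\<close>

definition weighted :: "('b \<Rightarrow> real) \<Rightarrow> bool" where
  "weighted w \<longleftrightarrow> w \<in> borel_measurable L \<and> integrable L (\<lambda>y. H y * w y)"

definition upper :: "('b \<Rightarrow> real) \<Rightarrow> real" where
  "upper w = (\<integral>y. max (lo y * w y) (hi y * w y) \<partial>L)"

text \<open>This is the supremum of the absolute value of the integral of \<open>k * w\<close> over
  the band. Both signs need their own term because the band from \<open>exp (- h)\<close> to
  \<open>exp h\<close> is not symmetric about 0.\<close>

definition env :: "('b \<Rightarrow> real) \<Rightarrow> real" where
  "env w = max (upper w) (upper (\<lambda>y. - w y))"

lemma H_nonneg: "0 \<le> H y"
  using lo_H[of y] by linarith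

lemma C_nonneg: "0 \<le> C"
proof -
  obtain x where x: "x \<in> space M" using not_empty by blast
  have "0 \<le> (\<integral>y. H y * K x y \<partial>L)"
    by (intro integral_nonneg_AE) (auto simp: H_nonneg K_nonneg)
  then show ?thesis using HK_le[OF x] by linarith
qed

lemma mean_meas [measurable]: "mean \<in> borel_measurable L"
proof -
  have "(\<lambda>(y, x). K x y) \<in> borel_measurable (L \<Otimes>\<^sub>M M)" by measurable
  then show ?thesis unfolding mean_def by measurable
qed

lemma weighted_meas: "weighted w \<Longrightarrow> w \<in> borel_measurable L"
  by (simp add: weighted_def)

lemma weighted_int:
  assumes "weighted w" "k \<in> borel_measurable L" "\<And>y. \<bar>k y\<bar> \<le> H y"
  shows "integrable L (\<lambda>y. k y * w y)"
proof (rule Bochner_Integration.integrable_bound)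
  show "integrable L (\<lambda>y. H y * w y)" using assms by (simp add: weighted_def)
  show "(\<lambda>y. k y * w y) \<in> borel_measurable L" using assms by (auto simp: weighted_def)
  show "AE y in L. norm (k y * w y) \<le> norm (H y * w y)"
    using assms(3) H_nonneg by (auto simp: abs_mult intro!: mult_right_mono)
qed

lemma weighted_max_int:
  assumes "weighted w"
  shows "integrable L (\<lambda>y. max (lo y * w y) (hi y * w y))"
  using assms lo_H hi_H by (intro integrable_max weighted_int) auto

lemma weighted_zero [simp, intro!]: "weighted (\<lambda>y. 0)"
  and weighted_add [intro!]: "weighted u \<Longrightarrow> weighted v \<Longrightarrow> weighted (\<lambda>y. u y + v y)"
  and weighted_diff [intro!]: "weighted u \<Longrightarrow> weighted v \<Longrightarrow> weighted (\<lambda>y. u y - v y)"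
  and weighted_uminus [intro!]: "weighted u \<Longrightarrow> weighted (\<lambda>y. - u y)"
  and weighted_cmult [intro!]: "weighted u \<Longrightarrow> weighted (\<lambda>y. a * u y)"
  by (auto simp: weighted_def algebra_simps mult.left_commute[of _ a])

lemma weighted_sum [intro!]: "(\<And>i. i \<in> I \<Longrightarrow> weighted (f i)) \<Longrightarrow> weighted (\<lambda>y. \<Sum>i\<in>I. f i y)"
  by (induction I rule: infinite_finite_induct) auto

lemma weighted_K [intro!]: "x \<in> space M \<Longrightarrow> weighted (K x)"
  using HK_int by (auto simp: weighted_def)

text \<open>The uniform bound \<open>C\<close> and the finiteness of \<open>M\<close> make the
  iterated integral of the majorant finite. This licenses the exchange of integrals behind
  \<open>integral_mean\<close> and \<open>weighted_mean\<close>.\<close>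

lemma pair_integrable:
  assumes "k \<in> borel_measurable L" "\<And>y. \<bar>k y\<bar> \<le> H y"
  shows "integrable (M \<Otimes>\<^sub>M L) (\<lambda>(x, y). k y * K x y)"
proof (rule Bochner_Integration.integrable_bound)
  show "integrable (M \<Otimes>\<^sub>M L) (\<lambda>(x, y). H y * K x y)"
  proof (rule KL.Fubini_integrable)
    have "integrable M (\<lambda>x. \<integral>y. H y * K x y \<partial>L)"
    proof (rule integrable_const_bound[where B = C])
      show "AE x in M. norm (\<integral>y. H y * K x y \<partial>L) \<le> C"
      proof (rule AE_I2)
        fix x assume "x \<in> space M"
        moreover have "0 \<le> (\<integral>y. H y * K x y \<partial>L)"
          by (intro integral_nonneg_AE) (auto simp: H_nonneg K_nonneg)
        ultimately show "norm (\<integral>y. H y * K x y \<partial>L) \<le> C" using HK_le by simp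
      qed
    qed measurable
    then show "integrable M (\<lambda>x. \<integral>y. norm (case (x, y) of (x, y) \<Rightarrow> H y * K x y) \<partial>L)"
      by (simp add: abs_mult H_nonneg K_nonneg)
  qed (auto simp: HK_int)
  show "(\<lambda>(x, y). k y * K x y) \<in> borel_measurable (M \<Otimes>\<^sub>M L)" using assms by measurable
  show "AE z in M \<Otimes>\<^sub>M L. norm (case z of (x, y) \<Rightarrow> k y * K x y) \<le> norm (case z of (x, y) \<Rightarrow> H y * K x y)"
    using assms(2) by (intro AE_I2) (auto simp: abs_mult H_nonneg intro!: mult_right_mono)
qed

lemma integral_mean:
  assumes "k \<in> borel_measurable L" "\<And>y. \<bar>k y\<bar> \<le> H y"
  shows "(\<integral>y. k y * mean y \<partial>L) = (\<integral>x. (\<integral>y. k y * K x y \<partial>L) \<partial>M)"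
    and "integrable M (\<lambda>x. \<integral>y. k y * K x y \<partial>L)"
  using KL.Fubini_integral[of "\<lambda>x y. k y * K x y"] pair_integrable[OF assms]
    KL.integrable_fst'[OF pair_integrable[OF assms]]
  by (simp_all add: mean_def)

lemma weighted_mean [intro!]: "weighted mean"
proof -
  have "integrable L (\<lambda>y. \<integral>x. H y * K x y \<partial>M)"
    using KL.integrable_snd[OF pair_integrable[of H]] by (simp add: H_nonneg)
  then show ?thesis by (auto simp: weighted_def mean_def[symmetric])
qed

lemma HM_le: "(\<integral>y. H y * mean y \<partial>L) \<le> C"
proof -
  have "(\<integral>y. H y * mean y \<partial>L) = (\<integral>x. (\<integral>y. H y * K x y \<partial>L) \<partial>M)"
    by (rule integral_mean) (auto simp: H_nonneg)
  also have "\<dots> \<le> (\<integral>x. C \<partial>M)"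
    by (intro integral_mono integral_mean) (auto simp: H_nonneg HK_le)
  finally show ?thesis by (simp add: prob_space)
qed

lemma integral_le_upper:
  assumes "weighted w" "k \<in> borel_measurable L" "\<And>y. lo y \<le> k y" "\<And>y. k y \<le> hi y"
  shows "(\<integral>y. k y * w y \<partial>L) \<le> upper w"
  unfolding upper_def
proof (rule integral_mono)
  have "\<bar>k y\<bar> \<le> H y" for y
    using assms(3,4)[of y] lo_H[of y] hi_H[of y] by linarith
  then show "integrable L (\<lambda>y. k y * w y)" using assms by (intro weighted_int) auto
  show "k y * w y \<le> max (lo y * w y) (hi y * w y)" for y
    using assms(3,4)[of y] by (cases "0 \<le> w y") (auto simp: le_max_iff_disj mult_right_mono mult_right_mono_neg)
qed (use assms in \<open>auto intro: weighted_max_int\<close>)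

lemma abs_integral_le_env:
  assumes "weighted w" "k \<in> borel_measurable L" "\<And>y. lo y \<le> k y" "\<And>y. k y \<le> hi y"
  shows "\<bar>\<integral>y. k y * w y \<partial>L\<bar> \<le> env w"
  using integral_le_upper[OF assms] integral_le_upper[OF weighted_uminus[OF assms(1)] assms(2-4)]
  unfolding env_def by (simp add: abs_if max_def)

definition maximizer :: "('b \<Rightarrow> real) \<Rightarrow> 'b \<Rightarrow> real" where
  "maximizer w y = (if 0 \<le> w y then hi y else lo y)"

lemma maximizer_meas [measurable]: "w \<in> borel_measurable L \<Longrightarrow> maximizer w \<in> borel_measurable L"
  unfolding maximizer_def by measurable

lemma maximizer_H: "\<bar>maximizer w y\<bar> \<le> H y"
  by (simp add: maximizer_def lo_H hi_H)

lemma upper_eq_maximizer: "upper w = (\<integral>y. maximizer w y * w y \<partial>L)"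
  unfolding upper_def maximizer_def
  by (intro Bochner_Integration.integral_cong refl)
     (auto simp: max_def lo_hi mult_right_mono mult_right_mono_neg antisym not_le
        intro!: antisym[OF _ mult_right_mono_neg[OF lo_hi]] mult_right_mono[OF lo_hi])

lemma upper_add:
  assumes "weighted u" "weighted v"
  shows "upper (\<lambda>y. u y + v y) \<le> upper u + upper v"
proof -
  have "upper (\<lambda>y. u y + v y) = (\<integral>y. maximizer (\<lambda>y. u y + v y) y * u y + maximizer (\<lambda>y. u y + v y) y * v y \<partial>L)"
    by (simp add: upper_eq_maximizer algebra_simps)
  also have "\<dots> = (\<integral>y. maximizer (\<lambda>y. u y + v y) y * u y \<partial>L) + (\<integral>y. maximizer (\<lambda>y. u y + v y) y * v y \<partial>L)"
    using assms by (intro Bochner_Integration.integral_add weighted_int maximizer_H) (auto simp: weighted_def)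
  also have "\<dots> \<le> upper u + upper v"
    using assms by (intro add_mono integral_le_upper) (auto simp: weighted_def maximizer_def lo_hi)
  finally show ?thesis .
qed

lemma upper_scale: "0 \<le> a \<Longrightarrow> upper (\<lambda>y. a * w y) = a * upper w"
proof -
  assume a: "0 \<le> a"
  have "max (lo y * (a * w y)) (hi y * (a * w y)) = a * max (lo y * w y) (hi y * w y)" for y
    using a by (simp add: max_mult_distrib_left mult.left_commute)
  then show ?thesis by (simp add: upper_def)
qed

text \<open>Jensen's inequality for a supremum of linear functionals: the maximizer \<open>k\<close>
  of the averaged weight does not depend on \<open>x\<close>, so Fubini turns its value into an
  average over \<open>x\<close> of integrals that are each at most \<open>upper\<close> of the
  unaveraged weight.\<close>

lemma upper_mean:
  assumes "weighted u"
  shows "upper (\<lambda>y. u y + t * mean y) \<le> (\<integral>x. upper (\<lambda>y. u y + t * K x y) \<partial>M)"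
    and "integrable M (\<lambda>x. upper (\<lambda>y. u y + t * K x y))"
proof -
  note [measurable] = weighted_meas[OF assms]
  have bnd: "\<bar>upper (\<lambda>y. u y + t * K x y)\<bar> \<le> (\<integral>y. H y * \<bar>u y\<bar> \<partial>L) + \<bar>t\<bar> * C" if x: "x \<in> space M" for x
  proof -
    let ?w = "\<lambda>y. u y + t * K x y"
    have ww: "weighted ?w" using assms x by auto
    have "\<bar>upper ?w\<bar> \<le> (\<integral>y. \<bar>maximizer ?w y * ?w y\<bar> \<partial>L)"
      unfolding upper_eq_maximizer by simp
    also have "\<dots> \<le> (\<integral>y. H y * \<bar>u y\<bar> + \<bar>t\<bar> * (H y * K x y) \<partial>L)"
    proof (rule integral_mono)
      show "integrable L (\<lambda>y. \<bar>maximizer ?w y * ?w y\<bar>)"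
        using ww by (intro integrable_abs weighted_int maximizer_H) (auto simp: weighted_def)
      have "integrable L (\<lambda>y. \<bar>H y * u y\<bar>)" using assms by (auto simp: weighted_def)
      then show "integrable L (\<lambda>y. H y * \<bar>u y\<bar> + \<bar>t\<bar> * (H y * K x y))"
        using HK_int[OF x] by (simp add: abs_mult H_nonneg)
      show "\<bar>maximizer ?w y * ?w y\<bar> \<le> H y * \<bar>u y\<bar> + \<bar>t\<bar> * (H y * K x y)" for y
      proof -
        have "\<bar>maximizer ?w y * ?w y\<bar> \<le> H y * (\<bar>u y\<bar> + \<bar>t\<bar> * K x y)"
          unfolding abs_mult
          by (intro mult_mono maximizer_H order_trans[OF abs_triangle_ineq]) (auto simp: abs_mult K_nonneg H_nonneg)
        then show ?thesis by (simp add: algebra_simps)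
      qed
    qed
    also have "\<dots> = (\<integral>y. H y * \<bar>u y\<bar> \<partial>L) + \<bar>t\<bar> * (\<integral>y. H y * K x y \<partial>L)"
    proof -
      have "integrable L (\<lambda>y. \<bar>H y * u y\<bar>)" using assms by (auto simp: weighted_def)
      then show ?thesis using HK_int[OF x] by (simp add: abs_mult H_nonneg)
    qed
    also have "\<dots> \<le> (\<integral>y. H y * \<bar>u y\<bar> \<partial>L) + \<bar>t\<bar> * C"
      using HK_le[OF x] by (intro add_left_mono mult_left_mono) auto
    finally show ?thesis .
  qed
  show int: "integrable M (\<lambda>x. upper (\<lambda>y. u y + t * K x y))"
    by (rule integrable_const_bound[where B = "(\<integral>y. H y * \<bar>u y\<bar> \<partial>L) + \<bar>t\<bar> * C"])
       (use bnd in \<open>auto simp: upper_def\<close>)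
  define k where "k = maximizer (\<lambda>y. u y + t * mean y)"
  have [measurable]: "k \<in> borel_measurable L" and kH: "\<bar>k y\<bar> \<le> H y" for y
    unfolding k_def by (auto simp: maximizer_H)
  have ku: "integrable L (\<lambda>y. k y * u y)"
    using assms kH by (intro weighted_int) auto
  have kK: "integrable L (\<lambda>y. k y * K x y)" if "x \<in> space M" for x
    using that kH by (intro weighted_int) auto
  have kM: "integrable L (\<lambda>y. k y * mean y)"
    using kH by (intro weighted_int) auto
  have "upper (\<lambda>y. u y + t * mean y) = (\<integral>y. k y * u y + t * (k y * mean y) \<partial>L)"
    unfolding upper_eq_maximizer k_def[symmetric] by (simp add: algebra_simps)
  also have "\<dots> = (\<integral>y. k y * u y \<partial>L) + t * (\<integral>y. k y * mean y \<partial>L)"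
    using ku kM by simp
  also have "\<dots> = (\<integral>x. (\<integral>y. k y * u y \<partial>L) + t * (\<integral>y. k y * K x y \<partial>L) \<partial>M)"
    using integral_mean[of k] kH by (simp add: prob_space)
  also have "\<dots> \<le> (\<integral>x. upper (\<lambda>y. u y + t * K x y) \<partial>M)"
  proof (rule integral_mono[OF _ int])
    show "integrable M (\<lambda>x. (\<integral>y. k y * u y \<partial>L) + t * (\<integral>y. k y * K x y \<partial>L))"
      using integral_mean(2)[of k] kH by simp
    fix x assume x: "x \<in> space M"
    have "(\<integral>y. k y * u y \<partial>L) + t * (\<integral>y. k y * K x y \<partial>L) = (\<integral>y. k y * (u y + t * K x y) \<partial>L)"
      using ku kK[OF x] by (simp add: algebra_simps)
    also have "\<dots> \<le> upper (\<lambda>y. u y + t * K x y)"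
      using x assms by (intro integral_le_upper) (auto simp: k_def maximizer_def lo_hi)
    finally show "(\<integral>y. k y * u y \<partial>L) + t * (\<integral>y. k y * K x y \<partial>L) \<le> upper (\<lambda>y. u y + t * K x y)" .
  qed
  finally show "upper (\<lambda>y. u y + t * mean y) \<le> (\<integral>x. upper (\<lambda>y. u y + t * K x y) \<partial>M)" .
qed

lemma env_uminus [simp]: "env (\<lambda>y. - w y) = env w"
  by (simp add: env_def max.commute)

lemma env_add:
  assumes "weighted u" "weighted v"
  shows "env (\<lambda>y. u y + v y) \<le> env u + env v"
  using upper_add[OF assms] upper_add[OF weighted_uminus[OF assms(1)] weighted_uminus[OF assms(2)]]
  by (simp add: env_def max_def)

lemma env_scale: "0 \<le> a \<Longrightarrow> env (\<lambda>y. a * w y) = a * env w"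
  using upper_scale[of a w] upper_scale[of a "\<lambda>y. - w y"]
  by (simp add: env_def max_mult_distrib_left)

lemma env_zero [simp]: "env (\<lambda>y. 0) = 0"
  by (simp add: env_def upper_def)

lemma env_nonneg: "weighted w \<Longrightarrow> 0 \<le> env w"
  using abs_integral_le_env[of w hi] lo_hi by force

text \<open>Provides an actual member of the band, so that a supremum over the corresponding
  function class can be bounded from below by \<open>env w\<close>.\<close>

lemma env_attained:
  assumes w: "weighted w"
  obtains k where "k \<in> borel_measurable L" "\<And>y. lo y \<le> k y" "\<And>y. k y \<le> hi y" "env w = \<bar>\<integral>y. k y * w y \<partial>L\<bar>"
proof (cases "upper (\<lambda>y. - w y) \<le> upper w")
  case True
  then have "env w = (\<integral>y. maximizer w y * w y \<partial>L)"
    by (simp add: env_def upper_eq_maximizer[of w])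
  then have "env w = \<bar>\<integral>y. maximizer w y * w y \<partial>L\<bar>" using env_nonneg[OF w] by simp
  then show ?thesis
    using weighted_meas[OF w] by (intro that[of "maximizer w"]) (auto simp: maximizer_def lo_hi)
next
  case False
  define k where "k = maximizer (\<lambda>y. - w y)"
  have "env w = - (\<integral>y. k y * w y \<partial>L)"
    using False by (simp add: env_def upper_eq_maximizer[of "\<lambda>y. - w y"] k_def)
  then have "env w = \<bar>\<integral>y. k y * w y \<partial>L\<bar>" using env_nonneg[OF w] by simp
  then show ?thesis
    using weighted_meas[OF w] by (intro that[of k]) (auto simp: k_def maximizer_def lo_hi)
qed

text \<open>Reverse triangle inequality, the source of the bounded differences.\<close>

lemma env_diff:
  assumes "weighted u" "weighted v"
  shows "\<bar>env u - env v\<bar> \<le> env (\<lambda>y. u y - v y)"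
proof -
  have "env u \<le> env v + env (\<lambda>y. u y - v y)"
    using env_add[of v "\<lambda>y. u y - v y"] assms by auto
  moreover have "env v \<le> env u + env (\<lambda>y. u y - v y)"
    using env_add[of u "\<lambda>y. - (u y - v y)"] env_uminus[of "\<lambda>y. u y - v y"] weighted_uminus[of "\<lambda>y. u y - v y"] assms by auto
  ultimately show ?thesis by linarith
qed

lemma env_sum:
  assumes "finite I" "\<And>i. i \<in> I \<Longrightarrow> weighted (f i)"
  shows "env (\<lambda>y. \<Sum>i\<in>I. f i y) \<le> (\<Sum>i\<in>I. env (f i))"
  using assms
proof (induction I rule: finite_induct)
  case (insert i I)
  have "env (\<lambda>y. f i y + (\<Sum>i\<in>I. f i y)) \<le> env (f i) + env (\<lambda>y. \<Sum>i\<in>I. f i y)"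
    using insert.prems by (intro env_add weighted_sum) auto
  then show ?case using insert by force
qed simp

lemma env_le:
  assumes "weighted w" "\<And>y. 0 \<le> w y" "(\<integral>y. H y * w y \<partial>L) \<le> C"
  shows "env w \<le> C"
proof -
  have "upper v \<le> C" if "weighted v" "\<And>y. \<bar>v y\<bar> = w y" for v
  proof -
    have "upper v \<le> (\<integral>y. H y * w y \<partial>L)"
      unfolding upper_eq_maximizer
    proof (rule integral_mono)
      show "integrable L (\<lambda>y. maximizer v y * v y)"
        using that by (intro weighted_int maximizer_H) (auto simp: weighted_def)
      show "integrable L (\<lambda>y. H y * w y)" using assms by (simp add: weighted_def)
      fix y
      have "maximizer v y * v y \<le> \<bar>maximizer v y\<bar> * \<bar>v y\<bar>" by (simp flip: abs_mult)
      also have "\<dots> \<le> H y * w y" using that(2)[of y] maximizer_H[of v y] by (auto intro!: mult_right_mono)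
      finally show "maximizer v y * v y \<le> H y * w y" .
    qed
    then show ?thesis using assms by linarith
  qed
  from this[of w] this[of "\<lambda>y. - w y"] assms show ?thesis by (auto simp: env_def)
qed

lemma env_K_le: "x \<in> space M \<Longrightarrow> env (K x) \<le> C"
  by (intro env_le weighted_K K_nonneg HK_le)

lemma env_mean_le: "env mean \<le> C"
  by (intro env_le weighted_mean HM_le) (auto simp: mean_def K_nonneg intro!: integral_nonneg_AE)

lemma env_meas [measurable]:
  assumes [measurable]: "case_prod W \<in> borel_measurable (N \<Otimes>\<^sub>M L)"
  shows "(\<lambda>x. env (W x)) \<in> borel_measurable N"
  unfolding env_def upper_def by measurable

lemma env_mean:
  assumes "weighted u"
  shows "env (\<lambda>y. u y + t * mean y) \<le> (\<integral>x. env (\<lambda>y. u y + t * K x y) \<partial>M)"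
    and "integrable M (\<lambda>x. env (\<lambda>y. u y + t * K x y))"
proof -
  note i1 = upper_mean[OF assms, of t]
  note i2 = upper_mean[OF weighted_uminus[OF assms], of "-t"]
  have neg: "(\<lambda>y. - (u y + t * g y)) = (\<lambda>y. - u y + (- t) * g y)" for g :: "'b \<Rightarrow> real" by auto
  show int: "integrable M (\<lambda>x. env (\<lambda>y. u y + t * K x y))"
    unfolding env_def neg by (intro integrable_max i1 i2)
  have "upper (\<lambda>y. u y + t * mean y) \<le> (\<integral>x. env (\<lambda>y. u y + t * K x y) \<partial>M)"
    by (rule order_trans[OF i1(1)], rule integral_mono[OF i1(2) int]) (simp add: env_def)
  moreover have "upper (\<lambda>y. - u y + (- t) * mean y) \<le> (\<integral>x. env (\<lambda>y. u y + t * K x y) \<partial>M)"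
    by (rule order_trans[OF i2(1)], rule integral_mono[OF i2(2) int]) (auto simp: env_def simp flip: neg)
  ultimately show "env (\<lambda>y. u y + t * mean y) \<le> (\<integral>x. env (\<lambda>y. u y + t * K x y) \<partial>M)"
    unfolding env_def[of "\<lambda>y. u y + t * mean y"] neg by simp
qed

text \<open>Writing \<open>w + K x - mean\<close> as the midpoint of \<open>w + 2 * K x\<close> and \<open>w - 2 * mean\<close>
  symmetrizes one coordinate by convexity and Jensen, without a ghost sample.\<close>

lemma symmetrize_one:
  assumes w: "weighted w"
  shows "(\<integral>\<^sup>+x. ennreal (env (\<lambda>y. w y + (K x y - mean y))) \<partial>M)
    \<le> ennreal (1/2) * (\<Sum>e\<in>{-1,1}. \<integral>\<^sup>+x. ennreal (env (\<lambda>y. w y + 2 * e * K x y)) \<partial>M)"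
proof -
  note [measurable] = weighted_meas[OF w]
  have pt: "env (\<lambda>y. w y + (K x y - mean y)) \<le> 1/2 * env (\<lambda>y. w y + 2 * K x y) + 1/2 * env (\<lambda>y. w y + (-2) * mean y)"
    if x: "x \<in> space M" for x
  proof -
    have eq: "(\<lambda>y. w y + (K x y - mean y)) = (\<lambda>y. 1/2 * (w y + 2 * K x y) + 1/2 * (w y + (-2) * mean y))"
      by (auto simp: field_simps)
    have "env (\<lambda>y. w y + (K x y - mean y)) \<le> env (\<lambda>y. 1/2 * (w y + 2 * K x y)) + env (\<lambda>y. 1/2 * (w y + (-2) * mean y))"
      unfolding eq using w x by (intro env_add weighted_cmult weighted_add weighted_K weighted_mean) auto
    then show ?thesis by (simp only: env_scale)
  qed
  \<comment> \<open>Jensen replaces \<open>mean\<close> by \<open>K x\<close> under the integral.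
    This half of the midpoint thus supplies the sign -1, while the half with \<open>2 * K x\<close>
    is already the sign +1.\<close>
  have e1: "ennreal (env (\<lambda>y. w y + (-2) * mean y)) \<le> (\<integral>\<^sup>+x. ennreal (env (\<lambda>y. w y + (-2) * K x y)) \<partial>M)"
  proof (subst nn_integral_eq_integral[OF env_mean(2)[OF w]])
    show "AE x in M. 0 \<le> env (\<lambda>y. w y + (-2) * K x y)"
      using w by (intro AE_I2 env_nonneg weighted_add weighted_cmult weighted_K) auto
  qed (intro ennreal_leI env_mean w)
  have "(\<integral>\<^sup>+x. ennreal (env (\<lambda>y. w y + (K x y - mean y))) \<partial>M)
      \<le> (\<integral>\<^sup>+x. ennreal (1/2) * ennreal (env (\<lambda>y. w y + 2 * K x y)) + ennreal (1/2) * ennreal (env (\<lambda>y. w y + (-2) * mean y)) \<partial>M)"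
  proof (rule nn_integral_mono)
    fix x assume x: "x \<in> space M"
    have "ennreal (env (\<lambda>y. w y + (K x y - mean y))) \<le> ennreal (1/2 * env (\<lambda>y. w y + 2 * K x y) + 1/2 * env (\<lambda>y. w y + (-2) * mean y))"
      by (intro ennreal_leI pt x)
    also have "\<dots> = ennreal (1/2 * env (\<lambda>y. w y + 2 * K x y)) + ennreal (1/2 * env (\<lambda>y. w y + (-2) * mean y))"
      using w x by (intro ennreal_plus mult_nonneg_nonneg env_nonneg weighted_add weighted_cmult weighted_K weighted_mean) auto
    also have "\<dots> = ennreal (1/2) * ennreal (env (\<lambda>y. w y + 2 * K x y)) + ennreal (1/2) * ennreal (env (\<lambda>y. w y + (-2) * mean y))"
      using w x by (intro arg_cong2[where f = plus] ennreal_mult env_nonneg weighted_add weighted_cmult weighted_K weighted_mean) auto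
    finally show "ennreal (env (\<lambda>y. w y + (K x y - mean y))) \<le> ennreal (1/2) * ennreal (env (\<lambda>y. w y + 2 * K x y)) + ennreal (1/2) * ennreal (env (\<lambda>y. w y + (-2) * mean y))" .
  qed
  also have "\<dots> = ennreal (1/2) * (\<integral>\<^sup>+x. ennreal (env (\<lambda>y. w y + 2 * K x y)) \<partial>M) + ennreal (1/2) * ennreal (env (\<lambda>y. w y + (-2) * mean y))"
    by (subst nn_integral_add) (auto simp: nn_integral_cmult emeasure_space_1)
  also have "\<dots> \<le> ennreal (1/2) * (\<integral>\<^sup>+x. ennreal (env (\<lambda>y. w y + 2 * K x y)) \<partial>M) + ennreal (1/2) * (\<integral>\<^sup>+x. ennreal (env (\<lambda>y. w y + (-2) * K x y)) \<partial>M)"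
    by (intro add_left_mono mult_left_mono e1) auto
  also have "\<dots> = ennreal (1/2) * (\<Sum>e\<in>{-1,1}. \<integral>\<^sup>+x. ennreal (env (\<lambda>y. w y + 2 * e * K x y)) \<partial>M)"
    by (simp add: distrib_left add.commute)
  finally show ?thesis .
qed

text \<open>The offset \<open>w\<close> is kept general because it carries the coordinates not being
  treated: it absorbs the centred sum over \<open>I\<close> when the new coordinate is symmetrized,
  and the signed term of the new coordinate when the induction hypothesis treats the rest.\<close>

lemma symmetrize:
  assumes "finite I" "weighted w"
  shows "(\<integral>\<^sup>+X. ennreal (env (\<lambda>y. w y + (\<Sum>i\<in>I. K (X i) y - mean y))) \<partial>PiM I (\<lambda>_. M))
    \<le> ennreal ((1/2) ^ card I) * (\<Sum>\<epsilon>\<in>PiE I (\<lambda>_. {-1,1}).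
        \<integral>\<^sup>+X. ennreal (env (\<lambda>y. w y + 2 * (\<Sum>i\<in>I. \<epsilon> i * K (X i) y))) \<partial>PiM I (\<lambda>_. M))"
  using assms
proof (induction I arbitrary: w)
  case empty
  then show ?case by (simp add: PiM_empty nn_integral_count_space_finite)
next
  case (insert j I)
  interpret P: product_sigma_finite "\<lambda>_. M"
    by (simp add: product_sigma_finite_def sigma_finite_measure_axioms)
  interpret PI: prob_space "PiM I (\<lambda>_. M)"
    by (intro prob_space_PiM prob_space_axioms)
  interpret Q: pair_sigma_finite "PiM I (\<lambda>_. M)" M by unfold_locales
  note [measurable] = weighted_meas[OF insert.prems]
  have sp: "X i \<in> space M" if "X \<in> space (PiM I (\<lambda>_. M))" "i \<in> I" for X i
    using that by (auto simp: space_PiM)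
  have upd1: "(\<Sum>i\<in>insert j I. K ((X(j := x)) i) y - mean y) = (\<Sum>i\<in>I. K (X i) y - mean y) + (K x y - mean y)" for X x y
  proof -
    have "(\<Sum>i\<in>I. K ((X(j := x)) i) y - mean y) = (\<Sum>i\<in>I. K (X i) y - mean y)"
      using insert.hyps by (intro sum.cong) auto
    then show ?thesis using insert.hyps by (simp add: add.commute)
  qed
  have upd2: "(\<Sum>i\<in>insert j I. (\<epsilon>(j := e)) i * K ((X(j := x)) i) y) = e * K x y + (\<Sum>i\<in>I. \<epsilon> i * K (X i) y)" for \<epsilon> e X x y
  proof -
    have "(\<Sum>i\<in>I. (\<epsilon>(j := e)) i * K ((X(j := x)) i) y) = (\<Sum>i\<in>I. \<epsilon> i * K (X i) y)"
      using insert.hyps by (intro sum.cong) auto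
    then show ?thesis using insert.hyps by simp
  qed
  have half: "ennreal (1/2) * ennreal ((1/2) ^ card I) = ennreal ((1/2) ^ card (insert j I))"
    unfolding card_insert_disjoint[OF insert.hyps] power_Suc by (rule ennreal_mult[symmetric]) auto
  have "(\<integral>\<^sup>+X. ennreal (env (\<lambda>y. w y + (\<Sum>i\<in>insert j I. K (X i) y - mean y))) \<partial>PiM (insert j I) (\<lambda>_. M))
    = (\<integral>\<^sup>+X. \<integral>\<^sup>+x. ennreal (env (\<lambda>y. (w y + (\<Sum>i\<in>I. K (X i) y - mean y)) + (K x y - mean y))) \<partial>M \<partial>PiM I (\<lambda>_. M))"
    using insert.hyps
    by (subst P.product_nn_integral_insert) (auto simp only: upd1 add.assoc, measurable)
  also have "\<dots> \<le> (\<integral>\<^sup>+X. ennreal (1/2) * (\<Sum>e\<in>{-1,1}. \<integral>\<^sup>+x. ennreal (env (\<lambda>y. (w y + (\<Sum>i\<in>I. K (X i) y - mean y)) + 2 * e * K x y)) \<partial>M) \<partial>PiM I (\<lambda>_. M))"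
    using insert.prems sp by (intro nn_integral_mono symmetrize_one) auto
  also have "\<dots> = ennreal (1/2) * (\<Sum>e\<in>{-1,1}. \<integral>\<^sup>+X. \<integral>\<^sup>+x. ennreal (env (\<lambda>y. (w y + (\<Sum>i\<in>I. K (X i) y - mean y)) + 2 * e * K x y)) \<partial>M \<partial>PiM I (\<lambda>_. M))"
    by (subst nn_integral_cmult, measurable, subst nn_integral_sum, measurable)
  \<comment> \<open>The order of integration is exchanged so that \<open>x\<close> is frozen while
    the sample over \<open>I\<close> varies; \<open>w + 2 * e * K x\<close> is then an admissible
    offset for the induction hypothesis.\<close>
  also have "\<dots> = ennreal (1/2) * (\<Sum>e\<in>{-1,1}. \<integral>\<^sup>+x. \<integral>\<^sup>+X. ennreal (env (\<lambda>y. (w y + 2 * e * K x y) + (\<Sum>i\<in>I. K (X i) y - mean y))) \<partial>PiM I (\<lambda>_. M) \<partial>M)"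
    by (intro arg_cong2[where f = times] sum.cong refl, subst Q.Fubini', measurable, simp only: add_ac)
  also have "\<dots> \<le> ennreal (1/2) * (\<Sum>e\<in>{-1,1}. \<integral>\<^sup>+x. ennreal ((1/2) ^ card I) * (\<Sum>\<epsilon>\<in>PiE I (\<lambda>_. {-1,1}).
        \<integral>\<^sup>+X. ennreal (env (\<lambda>y. (w y + 2 * e * K x y) + 2 * (\<Sum>i\<in>I. \<epsilon> i * K (X i) y))) \<partial>PiM I (\<lambda>_. M)) \<partial>M)"
    using insert.prems by (intro mult_left_mono sum_mono nn_integral_mono insert.IH) auto
  also have "\<dots> = ennreal (1/2) * (\<Sum>e\<in>{-1,1}. ennreal ((1/2) ^ card I) * (\<Sum>\<epsilon>\<in>PiE I (\<lambda>_. {-1,1}).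
        \<integral>\<^sup>+x. \<integral>\<^sup>+X. ennreal (env (\<lambda>y. (w y + 2 * e * K x y) + 2 * (\<Sum>i\<in>I. \<epsilon> i * K (X i) y))) \<partial>PiM I (\<lambda>_. M) \<partial>M))"
    by (intro arg_cong2[where f = times] sum.cong refl, subst nn_integral_cmult, measurable, subst nn_integral_sum, measurable)
  also have "\<dots> = ennreal (1/2) * ennreal ((1/2) ^ card I) * (\<Sum>e\<in>{-1,1}. \<Sum>\<epsilon>\<in>PiE I (\<lambda>_. {-1,1}).
        \<integral>\<^sup>+X. \<integral>\<^sup>+x. ennreal (env (\<lambda>y. w y + 2 * (e * K x y + (\<Sum>i\<in>I. \<epsilon> i * K (X i) y)))) \<partial>M \<partial>PiM I (\<lambda>_. M))"
    unfolding sum_distrib_left[symmetric] mult.assoc[symmetric, of "ennreal (1/2)"]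
    by (intro arg_cong2[where f = times] sum.cong refl, subst Q.Fubini', measurable,
        simp only: distrib_left mult.assoc add.assoc)
  also have "\<dots> = ennreal ((1/2) ^ card (insert j I)) * (\<Sum>e\<in>{-1,1}. \<Sum>\<epsilon>\<in>PiE I (\<lambda>_. {-1,1}).
        \<integral>\<^sup>+X. \<integral>\<^sup>+x. ennreal (env (\<lambda>y. w y + 2 * (\<Sum>i\<in>insert j I. (\<epsilon>(j := e)) i * K ((X(j := x)) i) y))) \<partial>M \<partial>PiM I (\<lambda>_. M))"
    by (simp only: half upd2)
  also have "\<dots> = ennreal ((1/2) ^ card (insert j I)) * (\<Sum>e\<in>{-1,1}. \<Sum>\<epsilon>\<in>PiE I (\<lambda>_. {-1,1}).
        \<integral>\<^sup>+X. ennreal (env (\<lambda>y. w y + 2 * (\<Sum>i\<in>insert j I. (\<epsilon>(j := e)) i * K (X i) y))) \<partial>PiM (insert j I) (\<lambda>_. M))"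
    by (intro arg_cong2[where f = times] sum.cong refl, subst P.product_nn_integral_insert[OF insert.hyps], measurable)
  also have "\<dots> = ennreal ((1/2) ^ card (insert j I)) * (\<Sum>\<epsilon>\<in>PiE (insert j I) (\<lambda>_. {-1,1}).
        \<integral>\<^sup>+X. ennreal (env (\<lambda>y. w y + 2 * (\<Sum>i\<in>insert j I. \<epsilon> i * K (X i) y))) \<partial>PiM (insert j I) (\<lambda>_. M))"
    by (simp only: sum_PiE_insert[OF insert.hyps])
  finally show ?case .
qed

section \<open>Deviation and Rademacher average as functions of the sample\<close>

text \<open>Sums are left unnormalized, so that the effect of replacing one sample point does not
  depend on the sample size; the factor \<open>1 / n\<close> enters in
  \<open>integral_diff_le_deviation\<close>.\<close>

definition deviation :: "'i set \<Rightarrow> ('i \<Rightarrow> 'a) \<Rightarrow> real" where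
  "deviation I X = env (\<lambda>y. \<Sum>i\<in>I. K (X i) y - mean y)"

text \<open>The real-valued, measurable counterpart of \<open>rad_avg\<close>, with
  \<open>env\<close> in place of the supremum over the class.\<close>

definition rademacher :: "'i set \<Rightarrow> ('i \<Rightarrow> 'a) \<Rightarrow> real" where
  "rademacher I X = (1/2) ^ card I * (\<Sum>\<epsilon>\<in>PiE I (\<lambda>_. {-1,1}). env (\<lambda>y. \<Sum>i\<in>I. \<epsilon> i * K (X i) y))"

lemma deviation_meas [measurable]: "deviation I \<in> borel_measurable (PiM I (\<lambda>_. M))"
  unfolding deviation_def by measurable

lemma rademacher_meas [measurable]: "rademacher I \<in> borel_measurable (PiM I (\<lambda>_. M))"
  unfolding rademacher_def by measurable

context
  fixes I :: "'i set"
  assumes fin: "finite I"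
begin

lemma card_signs: "card (PiE I (\<lambda>_. {-1, 1::real})) = 2 ^ card I"
  using fin by (simp add: card_PiE numeral_2_eq_2)

lemma space_PiM_D: "X \<in> space (PiM I (\<lambda>_. M)) \<Longrightarrow> i \<in> I \<Longrightarrow> X i \<in> space M"
  by (auto simp: space_PiM)

lemma rademacher_average_le:
  fixes c :: real
  assumes "\<And>\<epsilon>. \<epsilon> \<in> PiE I (\<lambda>_. {-1, 1::real}) \<Longrightarrow> g \<epsilon> \<le> c"
  shows "(1/2) ^ card I * (\<Sum>\<epsilon>\<in>PiE I (\<lambda>_. {-1, 1::real}). g \<epsilon>) \<le> c"
proof -
  have "(\<Sum>\<epsilon>\<in>PiE I (\<lambda>_. {-1, 1::real}). g \<epsilon>) \<le> 2 ^ card I * c"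
    using sum_bounded_above[of "PiE I (\<lambda>_. {-1, 1::real})" g c] assms card_signs by simp
  then show ?thesis by (simp add: power_one_over field_simps)
qed

lemma env_sign_le:
  assumes "weighted u" "e \<in> {-1, 1::real}"
  shows "env (\<lambda>y. e * u y) = env u"
  using assms by auto

lemma deviation_bounds:
  assumes X: "X \<in> space (PiM I (\<lambda>_. M))"
  shows "0 \<le> deviation I X" "deviation I X \<le> real (card I) * (2 * C)"
proof -
  have w: "weighted (\<lambda>y. K (X i) y - mean y)" if "i \<in> I" for i
    using space_PiM_D[OF X that] by auto
  show "0 \<le> deviation I X" unfolding deviation_def using w by (intro env_nonneg weighted_sum)
  have "env (\<lambda>y. K (X i) y - mean y) \<le> 2 * C" if "i \<in> I" for i
  proof -
    have "env (\<lambda>y. K (X i) y + - mean y) \<le> env (K (X i)) + env (\<lambda>y. - mean y)"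
      using space_PiM_D[OF X that] by (intro env_add) auto
    also have "\<dots> \<le> C + C"
      unfolding env_uminus using space_PiM_D[OF X that] by (intro add_mono env_K_le env_mean_le)
    finally show ?thesis by simp
  qed
  then have "(\<Sum>i\<in>I. env (\<lambda>y. K (X i) y - mean y)) \<le> real (card I) * (2 * C)"
    using sum_bounded_above[of I _ "2 * C"] by simp
  then show "deviation I X \<le> real (card I) * (2 * C)"
    unfolding deviation_def using env_sum[of I "\<lambda>i y. K (X i) y - mean y"] fin w by fastforce
qed

lemma env_rademacher_bounds:
  assumes X: "X \<in> space (PiM I (\<lambda>_. M))" and e: "\<epsilon> \<in> PiE I (\<lambda>_. {-1, 1::real})"
  shows "weighted (\<lambda>y. \<Sum>i\<in>I. \<epsilon> i * K (X i) y)"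
    and "0 \<le> env (\<lambda>y. \<Sum>i\<in>I. \<epsilon> i * K (X i) y)"
    and "env (\<lambda>y. \<Sum>i\<in>I. \<epsilon> i * K (X i) y) \<le> real (card I) * C"
proof -
  have w: "weighted (\<lambda>y. \<epsilon> i * K (X i) y)" if "i \<in> I" for i
    using space_PiM_D[OF X that] by auto
  show ww: "weighted (\<lambda>y. \<Sum>i\<in>I. \<epsilon> i * K (X i) y)" using w by (intro weighted_sum)
  show "0 \<le> env (\<lambda>y. \<Sum>i\<in>I. \<epsilon> i * K (X i) y)" by (intro env_nonneg ww)
  have "env (\<lambda>y. \<epsilon> i * K (X i) y) \<le> C" if "i \<in> I" for i
    using env_sign_le[OF weighted_K, of "X i" "\<epsilon> i"] env_K_le[of "X i"] space_PiM_D[OF X that] PiE_mem[OF e that] by simp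
  then have "(\<Sum>i\<in>I. env (\<lambda>y. \<epsilon> i * K (X i) y)) \<le> real (card I) * C"
    using sum_bounded_above[of I _ C] by simp
  then show "env (\<lambda>y. \<Sum>i\<in>I. \<epsilon> i * K (X i) y) \<le> real (card I) * C"
    using env_sum[of I "\<lambda>i y. \<epsilon> i * K (X i) y"] fin w by fastforce
qed

lemma rademacher_bounds:
  assumes X: "X \<in> space (PiM I (\<lambda>_. M))"
  shows "0 \<le> rademacher I X" "rademacher I X \<le> real (card I) * C"
  unfolding rademacher_def
  using env_rademacher_bounds[OF X]
  by (auto intro!: rademacher_average_le mult_nonneg_nonneg sum_nonneg)

lemma env_K_diff_le:
  assumes "x \<in> space M" "x' \<in> space M"
  shows "env (\<lambda>y. K x y - K x' y) \<le> 2 * C"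
proof -
  have "env (\<lambda>y. K x y + - K x' y) \<le> env (K x) + env (\<lambda>y. - K x' y)"
    using assms by (intro env_add) auto
  also have "\<dots> \<le> C + C"
    unfolding env_uminus using assms by (intro add_mono env_K_le)
  finally show ?thesis by simp
qed

text \<open>The two weights differ by \<open>K x - K (X i)\<close> only, and \<open>env\<close> of
  each term is at most \<open>C\<close>.\<close>

lemma deviation_diff:
  assumes X: "X \<in> space (PiM I (\<lambda>_. M))" and i: "i \<in> I" and x: "x \<in> space M"
  shows "\<bar>deviation I (X(i := x)) - deviation I X\<bar> \<le> 2 * C"
proof -
  note sp = space_PiM_D[OF X]
  have "(\<Sum>j\<in>I. K ((X(i := x)) j) y - mean y) - (\<Sum>j\<in>I. K (X j) y - mean y) = K x y - K (X i) y" for y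
    using fin i by (simp add: sum.remove[of I i])
  moreover have "\<bar>deviation I (X(i := x)) - deviation I X\<bar>
      \<le> env (\<lambda>y. (\<Sum>j\<in>I. K ((X(i := x)) j) y - mean y) - (\<Sum>j\<in>I. K (X j) y - mean y))"
    unfolding deviation_def using sp x by (intro env_diff) auto
  ultimately show ?thesis using env_K_diff_le[OF x sp[OF i]] by simp
qed

lemma rademacher_diff:
  assumes X: "X \<in> space (PiM I (\<lambda>_. M))" and i: "i \<in> I" and x: "x \<in> space M"
  shows "\<bar>rademacher I (X(i := x)) - rademacher I X\<bar> \<le> 2 * C"
proof -
  note sp = space_PiM_D[OF X]
  have *: "\<bar>env (\<lambda>y. \<Sum>j\<in>I. \<epsilon> j * K ((X(i := x)) j) y) - env (\<lambda>y. \<Sum>j\<in>I. \<epsilon> j * K (X j) y)\<bar> \<le> 2 * C"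
    if e: "\<epsilon> \<in> PiE I (\<lambda>_. {-1, 1::real})" for \<epsilon>
  proof -
    have "(\<Sum>j\<in>I. \<epsilon> j * K ((X(i := x)) j) y) - (\<Sum>j\<in>I. \<epsilon> j * K (X j) y) = \<epsilon> i * (K x y - K (X i) y)" for y
      using fin i by (simp add: sum.remove[of I i] algebra_simps)
    moreover have "\<bar>env (\<lambda>y. \<Sum>j\<in>I. \<epsilon> j * K ((X(i := x)) j) y) - env (\<lambda>y. \<Sum>j\<in>I. \<epsilon> j * K (X j) y)\<bar>
        \<le> env (\<lambda>y. (\<Sum>j\<in>I. \<epsilon> j * K ((X(i := x)) j) y) - (\<Sum>j\<in>I. \<epsilon> j * K (X j) y))"
      using sp x by (intro env_diff) auto
    moreover have "env (\<lambda>y. \<epsilon> i * (K x y - K (X i) y)) = env (\<lambda>y. K x y - K (X i) y)"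
      using sp[OF i] x PiE_mem[OF e i] by (intro env_sign_le) auto
    ultimately show ?thesis using env_K_diff_le[OF x sp[OF i]] by simp
  qed
  have "\<bar>rademacher I (X(i := x)) - rademacher I X\<bar> = (1/2) ^ card I * \<bar>\<Sum>\<epsilon>\<in>PiE I (\<lambda>_. {-1,1}).
      env (\<lambda>y. \<Sum>j\<in>I. \<epsilon> j * K ((X(i := x)) j) y) - env (\<lambda>y. \<Sum>j\<in>I. \<epsilon> j * K (X j) y)\<bar>"
    unfolding rademacher_def right_diff_distrib[symmetric] sum_subtractf[symmetric] abs_mult by simp
  also have "\<dots> \<le> (1/2) ^ card I * (\<Sum>\<epsilon>\<in>PiE I (\<lambda>_. {-1,1}).
      \<bar>env (\<lambda>y. \<Sum>j\<in>I. \<epsilon> j * K ((X(i := x)) j) y) - env (\<lambda>y. \<Sum>j\<in>I. \<epsilon> j * K (X j) y)\<bar>)"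
    by (intro mult_left_mono sum_abs) auto
  also have "\<dots> \<le> 2 * C" by (intro rademacher_average_le *)
  finally show ?thesis .
qed

text \<open>This is \<open>symmetrize\<close> with zero offset; the factor 2 inside
  \<open>env\<close> comes out by homogeneity. The comparison is made with nonnegative extended
  integrals and carried back to real ones by boundedness.\<close>

lemma expectation_deviation_le:
  "(\<integral>X. deviation I X \<partial>PiM I (\<lambda>_. M)) \<le> 2 * (\<integral>X. rademacher I X \<partial>PiM I (\<lambda>_. M))"
  and integrable_deviation: "integrable (PiM I (\<lambda>_. M)) (deviation I)"
  and integrable_rademacher: "integrable (PiM I (\<lambda>_. M)) (rademacher I)"
proof -
  interpret PI: prob_space "PiM I (\<lambda>_. M)"
    by (intro prob_space_PiM prob_space_axioms)
  show intd: "integrable (PiM I (\<lambda>_. M)) (deviation I)"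
    by (rule PI.integrable_const_bound[where B = "real (card I) * (2 * C)"])
       (use deviation_bounds in auto)
  show intr: "integrable (PiM I (\<lambda>_. M)) (rademacher I)"
    by (rule PI.integrable_const_bound[where B = "real (card I) * C"])
       (use rademacher_bounds in auto)
  have "ennreal (\<integral>X. deviation I X \<partial>PiM I (\<lambda>_. M)) = (\<integral>\<^sup>+X. ennreal (deviation I X) \<partial>PiM I (\<lambda>_. M))"
    by (intro nn_integral_eq_integral[symmetric] intd AE_I2 deviation_bounds)
  also have "\<dots> \<le> ennreal ((1/2) ^ card I) * (\<Sum>\<epsilon>\<in>PiE I (\<lambda>_. {-1,1}).
        \<integral>\<^sup>+X. ennreal (env (\<lambda>y. 2 * (\<Sum>i\<in>I. \<epsilon> i * K (X i) y))) \<partial>PiM I (\<lambda>_. M))"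
    using symmetrize[OF fin weighted_zero] by (simp add: deviation_def)
  also have "\<dots> = (\<integral>\<^sup>+X. ennreal ((1/2) ^ card I) * (\<Sum>\<epsilon>\<in>PiE I (\<lambda>_. {-1,1}).
        ennreal (env (\<lambda>y. 2 * (\<Sum>i\<in>I. \<epsilon> i * K (X i) y)))) \<partial>PiM I (\<lambda>_. M))"
    by (subst nn_integral_cmult, measurable, subst nn_integral_sum, measurable)
  also have "\<dots> = (\<integral>\<^sup>+X. ennreal (2 * rademacher I X) \<partial>PiM I (\<lambda>_. M))"
  proof (rule nn_integral_cong)
    fix X assume X: "X \<in> space (PiM I (\<lambda>_. M))"
    have "(\<Sum>\<epsilon>\<in>PiE I (\<lambda>_. {-1,1}). ennreal (env (\<lambda>y. 2 * (\<Sum>i\<in>I. \<epsilon> i * K (X i) y))))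
      = ennreal (\<Sum>\<epsilon>\<in>PiE I (\<lambda>_. {-1,1}). 2 * env (\<lambda>y. \<Sum>i\<in>I. \<epsilon> i * K (X i) y))"
      using env_rademacher_bounds(2)[OF X] by (subst sum_ennreal[symmetric]) (auto simp: env_scale)
    then show "ennreal ((1/2) ^ card I) * (\<Sum>\<epsilon>\<in>PiE I (\<lambda>_. {-1,1}). ennreal (env (\<lambda>y. 2 * (\<Sum>i\<in>I. \<epsilon> i * K (X i) y))))
        = ennreal (2 * rademacher I X)"
      using env_rademacher_bounds(2)[OF X]
      by (simp add: rademacher_def sum_nonneg sum_distrib_left mult_ac flip: ennreal_mult)
  qed
  also have "\<dots> = ennreal (\<integral>X. 2 * rademacher I X \<partial>PiM I (\<lambda>_. M))"
    by (intro nn_integral_eq_integral integrable_mult_right intr AE_I2 mult_nonneg_nonneg rademacher_bounds) auto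
  finally show "(\<integral>X. deviation I X \<partial>PiM I (\<lambda>_. M)) \<le> 2 * (\<integral>X. rademacher I X \<partial>PiM I (\<lambda>_. M))"
    using rademacher_bounds by (subst (asm) ennreal_le_iff) (auto intro!: mult_nonneg_nonneg integral_nonneg_AE)
qed

text \<open>One point changes \<open>deviation\<close> by at most \<open>2 * C\<close> and
  \<open>2 * rademacher\<close> by at most \<open>4 * C\<close>, hence the differences
  \<open>6 * C\<close> and the constant \<open>6^2 / 2 = 18\<close>. The mean is nonpositive by
  symmetrization, so its term is dropped.\<close>

lemma mgf_deviation_minus_rademacher:
  assumes "l > 0"
  shows "(\<integral>\<^sup>+X. ennreal (exp (l * (deviation I X - 2 * rademacher I X))) \<partial>PiM I (\<lambda>_. M))
    \<le> ennreal (exp (18 * real (card I) * l\<^sup>2 * C\<^sup>2))"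
proof -
  let ?f = "\<lambda>X. deviation I X - 2 * rademacher I X"
  have "(\<integral>\<^sup>+X. ennreal (exp (l * ?f X)) \<partial>PiM I (\<lambda>_. M))
    \<le> ennreal (exp (l * (\<integral>X. ?f X \<partial>PiM I (\<lambda>_. M)) + real (card I) * l\<^sup>2 * (6 * C)\<^sup>2 / 2))"
  proof (rule mgf_bounded_differences[OF fin _ assms])
    show "\<bar>?f X\<bar> \<le> real (card I) * (4 * C)" if "X \<in> space (PiM I (\<lambda>_. M))" for X
      using deviation_bounds[OF that] rademacher_bounds[OF that] C_nonneg by (simp add: abs_le_iff)
    show "\<bar>?f (X(i := x)) - ?f X\<bar> \<le> 6 * C"
      if "X \<in> space (PiM I (\<lambda>_. M))" "i \<in> I" "x \<in> space M" for X i x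
      using deviation_diff[OF that] rademacher_diff[OF that] by linarith
  qed measurable
  also have "\<dots> \<le> ennreal (exp (18 * real (card I) * l\<^sup>2 * C\<^sup>2))"
  proof -
    have "(\<integral>X. ?f X \<partial>PiM I (\<lambda>_. M)) \<le> 0"
      using integrable_deviation integrable_rademacher expectation_deviation_le by simp
    then have "l * (\<integral>X. ?f X \<partial>PiM I (\<lambda>_. M)) \<le> 0"
      using assms by (simp add: mult_nonneg_nonpos)
    then show ?thesis by (intro ennreal_leI) (simp add: power_mult_distrib)
  qed
  finally show ?thesis .
qed

end

end

section \<open>Gaussian smoothing\<close>

lemma nn_integral_exp_neg_square:
  assumes "s > 0"
  shows "(\<integral>\<^sup>+x. ennreal (exp (- s * (x::real)\<^sup>2)) \<partial>lborel) = ennreal (sqrt (pi / s))"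
proof -
  have eq: "exp (- s * x\<^sup>2) = sqrt (pi / s) * normal_density 0 (sqrt (1 / (2 * s))) x" for x
    using assms by (simp add: normal_density_def field_simps)
  have pos: "0 < sqrt (1 / (2 * s))" using assms by simp
  have "(\<integral>\<^sup>+x. ennreal (exp (- s * (x::real)\<^sup>2)) \<partial>lborel)
      = ennreal (\<integral>x. sqrt (pi / s) * normal_density 0 (sqrt (1 / (2 * s))) x \<partial>lborel)"
    unfolding eq using pos assms
    by (intro nn_integral_eq_integral integrable_mult_right integrable_normal_density) auto
  then show ?thesis using pos by simp
qed

lemma nn_integral_exp_neg_norm_square:
  assumes "s > 0"
  shows "(\<integral>\<^sup>+x. ennreal (exp (- s * (norm (x::'a::euclidean_space))\<^sup>2)) \<partial>lborel) = ennreal (sqrt (pi / s) ^ DIM('a))"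
proof -
  have "ennreal (exp (- s * (norm x)\<^sup>2)) = (\<Prod>b\<in>Basis. ennreal (exp (- s * (x \<bullet> b)\<^sup>2)))" for x :: 'a
  proof -
    have "(norm x)\<^sup>2 = (\<Sum>b\<in>Basis. (x \<bullet> b)\<^sup>2)"
      unfolding power2_norm_eq_inner by (subst euclidean_inner) (simp add: power2_eq_square)
    then have "exp (- s * (norm x)\<^sup>2) = (\<Prod>b\<in>Basis. exp (- s * (x \<bullet> b)\<^sup>2))"
      by (simp add: sum_distrib_left exp_sum flip: sum_negf)
    then show ?thesis by (simp add: prod_ennreal)
  qed
  then show ?thesis
    by (simp only:) (subst nn_integral_lborel_prod,
      use nn_integral_exp_neg_square[OF assms] assms in \<open>auto simp: ennreal_power\<close>)
qed

lemma gauss_dens_measurable [measurable]: "gauss_dens \<sigma> \<in> borel_measurable borel"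
  unfolding gauss_dens_def by measurable

lemma gauss_dens_minus_commute: "gauss_dens \<sigma> (x - y) = gauss_dens \<sigma> (y - x)"
  by (simp add: gauss_dens_def norm_minus_commute)

lemma gauss_dens_pos: "\<sigma> \<noteq> 0 \<Longrightarrow> 0 < gauss_dens \<sigma> x"
  by (simp add: gauss_dens_def)

lemma gauss_dens_nonneg: "0 \<le> gauss_dens \<sigma> x"
  by (simp add: gauss_dens_def)

lemma nn_integral_lborel_reflect:
  fixes f :: "'a::euclidean_space \<Rightarrow> ennreal"
  assumes [measurable]: "f \<in> borel_measurable borel"
  shows "(\<integral>\<^sup>+y. f (x - y) \<partial>lborel) = (\<integral>\<^sup>+y. f y \<partial>lborel)"
proof -
  have "lborel = distr lborel borel (\<lambda>y::'a. x - y)"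
    using lborel_affine[of "-1" x] by (simp add: density_1)
  then have "(\<integral>\<^sup>+y. f y \<partial>lborel) = (\<integral>\<^sup>+y. f y \<partial>distr lborel borel (\<lambda>y. x - y))"
    by (rule arg_cong)
  then show ?thesis by (simp add: nn_integral_distr)
qed

text \<open>The linear exponent is paid for with the fraction \<open>1 / (8 * D)\<close> of the
  Gaussian precision; a fraction of order \<open>1 / D\<close> keeps the loss in the normalizing
  constant bounded in every dimension.\<close>

lemma exp_norm_gauss_le:
  fixes y :: "'a::euclidean_space"
  assumes "\<sigma> > 0"
  defines "D \<equiv> real DIM('a)"
  shows "exp (b / 2 * norm y) * gauss_dens \<sigma> y \<le>
    exp (D * \<sigma>\<^sup>2 * b\<^sup>2) * (2 * pi * \<sigma>\<^sup>2) powr (- D / 2) * exp (- ((1 - 1 / (8 * D)) / (2 * \<sigma>\<^sup>2)) * (norm y)\<^sup>2)"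
proof -
  have D: "D \<ge> 1" unfolding D_def by (simp add: Suc_le_eq)
  \<comment> \<open>A square completed so that the cross term is exactly
    \<open>b / 2 * norm y\<close>; the remaining constant \<open>D * \<sigma>^2 * b^2\<close> is the
    dimension-dependent part of the exponent of \<open>xi_const\<close>.\<close>
  have "0 \<le> (D * \<sigma>\<^sup>2 * b - norm y / 4)\<^sup>2 / (D * \<sigma>\<^sup>2)" using D by simp
  also have "\<dots> = D * \<sigma>\<^sup>2 * b\<^sup>2 - b / 2 * norm y + (norm y)\<^sup>2 / (16 * D * \<sigma>\<^sup>2)"
    using D assms(1) by (simp add: field_simps power2_eq_square)
  finally have "b / 2 * norm y \<le> D * \<sigma>\<^sup>2 * b\<^sup>2 + (norm y)\<^sup>2 / (16 * D * \<sigma>\<^sup>2)" by simp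
  moreover have "(1 - 1 / (8 * D)) / (2 * \<sigma>\<^sup>2) * (norm y)\<^sup>2 = (norm y)\<^sup>2 / (2 * \<sigma>\<^sup>2) - (norm y)\<^sup>2 / (16 * D * \<sigma>\<^sup>2)"
    using D assms(1) by (simp add: field_simps)
  ultimately have "b / 2 * norm y - (norm y)\<^sup>2 / (2 * \<sigma>\<^sup>2) \<le> D * \<sigma>\<^sup>2 * b\<^sup>2 - (1 - 1 / (8 * D)) / (2 * \<sigma>\<^sup>2) * (norm y)\<^sup>2"
    by linarith
  then have "exp (b / 2 * norm y) * exp (- (norm y)\<^sup>2 / (2 * \<sigma>\<^sup>2))
      \<le> exp (D * \<sigma>\<^sup>2 * b\<^sup>2) * exp (- ((1 - 1 / (8 * D)) / (2 * \<sigma>\<^sup>2)) * (norm y)\<^sup>2)"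
    unfolding exp_add[symmetric] by simp
  then have "(2 * pi * \<sigma>\<^sup>2) powr (- D / 2) * (exp (b / 2 * norm y) * exp (- (norm y)\<^sup>2 / (2 * \<sigma>\<^sup>2)))
      \<le> (2 * pi * \<sigma>\<^sup>2) powr (- D / 2) * (exp (D * \<sigma>\<^sup>2 * b\<^sup>2) * exp (- ((1 - 1 / (8 * D)) / (2 * \<sigma>\<^sup>2)) * (norm y)\<^sup>2))"
    by (intro mult_left_mono) auto
  then show ?thesis by (simp only: gauss_dens_def D_def mult_ac)
qed

lemma nn_integral_exp_norm_gauss_le:
  assumes "\<sigma> > 0"
  shows "(\<integral>\<^sup>+y. ennreal (exp (b / 2 * norm (y::'a::euclidean_space)) * gauss_dens \<sigma> y) \<partial>lborel)
    \<le> ennreal (2 * exp (real DIM('a) * \<sigma>\<^sup>2 * b\<^sup>2))"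
proof -
  define D where "D = real DIM('a)"
  have D: "D \<ge> 1" unfolding D_def by (simp add: Suc_le_eq)
  define s where "s = (1 - 1 / (8 * D)) / (2 * \<sigma>\<^sup>2)"
  define c where "c = (2 * pi * \<sigma>\<^sup>2) powr (- D / 2)"
  have s: "s > 0" using D assms by (simp add: s_def field_simps)
  have "(\<integral>\<^sup>+y. ennreal (exp (b / 2 * norm (y::'a)) * gauss_dens \<sigma> y) \<partial>lborel)
      \<le> (\<integral>\<^sup>+y. ennreal (exp (D * \<sigma>\<^sup>2 * b\<^sup>2) * c) * ennreal (exp (- s * (norm (y::'a))\<^sup>2)) \<partial>lborel)"
    using exp_norm_gauss_le[OF assms, of b]
    by (intro nn_integral_mono) (auto simp: s_def c_def D_def simp flip: ennreal_mult intro!: ennreal_leI)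
  also have "\<dots> = ennreal (exp (D * \<sigma>\<^sup>2 * b\<^sup>2) * c) * ennreal (sqrt (pi / s) ^ DIM('a))"
    by (subst nn_integral_cmult) (simp_all only: nn_integral_exp_neg_norm_square[OF s], measurable)
  also have "\<dots> = ennreal (exp (D * \<sigma>\<^sup>2 * b\<^sup>2) * (c * sqrt (pi / s) ^ DIM('a)))"
    using s by (simp add: c_def mult.assoc flip: ennreal_mult)
  also have "\<dots> \<le> ennreal (exp (D * \<sigma>\<^sup>2 * b\<^sup>2) * 2)"
  proof (intro ennreal_leI mult_left_mono)
    \<comment> \<open>Bernoulli bounds the \<open>D\<close>-th power of
      \<open>1 - 1 / (8 * D)\<close> below by \<open>7 / 8\<close>, independently of
      \<open>D\<close>. The weaker bound \<open>1 / 4\<close> already gives the prefactor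
      \<open>sqrt 4 = 2\<close>.\<close>
    have "1 + real DIM('a) * (- 1 / (8 * D)) \<le> (1 + (- 1 / (8 * D))) ^ DIM('a)"
      using D by (intro Bernoulli_inequality) (simp add: field_simps)
    moreover have "1 + real DIM('a) * (- 1 / (8 * D)) = 7 / 8"
      using D unfolding D_def[symmetric] by simp
    ultimately have le: "1 / 4 \<le> (1 - 1 / (8 * D)) ^ DIM('a)" by simp
    have u: "0 < 1 - 1 / (8 * D)" using D by (simp add: field_simps)
    have c: "c = (1 / sqrt (2 * pi * \<sigma>\<^sup>2)) ^ DIM('a)"
    proof -
      have "c = ((2 * pi * \<sigma>\<^sup>2) powr (- 1 / 2)) powr D"
        by (simp add: c_def powr_powr)
      also have "(2 * pi * \<sigma>\<^sup>2) powr (- 1 / 2) = 1 / sqrt (2 * pi * \<sigma>\<^sup>2)"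
        using assms by (simp add: powr_minus_divide powr_half_sqrt)
      finally show ?thesis using assms by (simp add: D_def powr_realpow)
    qed
    have "c * sqrt (pi / s) ^ DIM('a) = sqrt (1 / (2 * pi * \<sigma>\<^sup>2) * (pi / s)) ^ DIM('a)"
      unfolding c by (simp only: power_mult_distrib[symmetric] real_sqrt_mult real_sqrt_divide real_sqrt_one)
    also have "1 / (2 * pi * \<sigma>\<^sup>2) * (pi / s) = 1 / (1 - 1 / (8 * D))"
      using assms u by (simp add: s_def)
    also have "sqrt (1 / (1 - 1 / (8 * D))) ^ DIM('a) = sqrt (1 / (1 - 1 / (8 * D)) ^ DIM('a))"
      by (simp add: real_sqrt_power power_one_over real_sqrt_divide power_divide)
    also have "\<dots> \<le> sqrt 4"
    proof (rule real_sqrt_le_mono)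
      show "1 / (1 - 1 / (8 * D)) ^ DIM('a) \<le> 4"
        using le u by (simp add: divide_le_eq zero_less_power)
    qed
    finally show "c * sqrt (pi / s) ^ DIM('a) \<le> 2" by simp
  qed auto
  finally show ?thesis by (simp add: D_def mult.commute)
qed

text \<open>The triangle inequality \<open>norm y \<le> r + norm (x - y)\<close> recentres the
  exponent at \<open>x\<close> for the factor \<open>exp (b / 2 * r)\<close>, and reflection reduces
  to the centred Gaussian.\<close>

lemma nn_integral_exp_gauss_shift_le:
  fixes x :: "'a::euclidean_space"
  assumes "\<sigma> > 0" "0 \<le> b" "norm x \<le> r"
  shows "(\<integral>\<^sup>+y. ennreal (exp (b / 2 * (1 + norm y)) * gauss_dens \<sigma> (x - y)) \<partial>lborel)
    \<le> ennreal (2 * exp (b / 2 * (1 + r) + real DIM('a) * \<sigma>\<^sup>2 * b\<^sup>2))"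
proof -
  have "(\<integral>\<^sup>+y. ennreal (exp (b / 2 * (1 + norm y)) * gauss_dens \<sigma> (x - y)) \<partial>lborel)
      \<le> (\<integral>\<^sup>+y. ennreal (exp (b / 2 * (1 + r))) * ennreal (exp (b / 2 * norm (x - y)) * gauss_dens \<sigma> (x - y)) \<partial>lborel)"
  proof (intro nn_integral_mono)
    fix y
    have "norm y \<le> r + norm (x - y)"
      using norm_triangle_ineq2[of y x] assms(3) by (simp add: norm_minus_commute)
    then have "b / 2 * (1 + norm y) \<le> b / 2 * (1 + r) + b / 2 * norm (x - y)"
      unfolding distrib_left[symmetric] using assms(2) by (intro mult_left_mono) auto
    then have "exp (b / 2 * (1 + norm y)) \<le> exp (b / 2 * (1 + r)) * exp (b / 2 * norm (x - y))"
      unfolding exp_add[symmetric] by simp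
    then have "exp (b / 2 * (1 + norm y)) * gauss_dens \<sigma> (x - y)
        \<le> exp (b / 2 * (1 + r)) * exp (b / 2 * norm (x - y)) * gauss_dens \<sigma> (x - y)"
      by (intro mult_right_mono gauss_dens_nonneg)
    then show "ennreal (exp (b / 2 * (1 + norm y)) * gauss_dens \<sigma> (x - y))
      \<le> ennreal (exp (b / 2 * (1 + r))) * ennreal (exp (b / 2 * norm (x - y)) * gauss_dens \<sigma> (x - y))"
      by (simp add: gauss_dens_nonneg mult.assoc ennreal_leI flip: ennreal_mult)
  qed
  also have "\<dots> = ennreal (exp (b / 2 * (1 + r))) * (\<integral>\<^sup>+y. ennreal (exp (b / 2 * norm (x - y)) * gauss_dens \<sigma> (x - y)) \<partial>lborel)"
    by (rule nn_integral_cmult) measurable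
  also have "(\<integral>\<^sup>+y. ennreal (exp (b / 2 * norm (x - y)) * gauss_dens \<sigma> (x - y)) \<partial>lborel)
      = (\<integral>\<^sup>+y. ennreal (exp (b / 2 * norm (y::'a)) * gauss_dens \<sigma> y) \<partial>lborel)"
    by (rule nn_integral_lborel_reflect[of "\<lambda>y. ennreal (exp (b / 2 * norm y) * gauss_dens \<sigma> y)"]) measurable
  also have "ennreal (exp (b / 2 * (1 + r))) * \<dots> \<le> ennreal (exp (b / 2 * (1 + r))) * ennreal (2 * exp (real DIM('a) * \<sigma>\<^sup>2 * b\<^sup>2))"
    by (intro mult_left_mono nn_integral_exp_norm_gauss_le assms) auto
  also have "\<dots> = ennreal (2 * exp (b / 2 * (1 + r) + real DIM('a) * \<sigma>\<^sup>2 * b\<^sup>2))"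
    by (subst ennreal_mult[symmetric]) (simp_all add: exp_add mult_ac)
  finally show ?thesis .
qed

text \<open>Explains the polynomial in \<open>xi_const\<close>: since
  \<open>\<sigma>^2 * b^2 = (r^2 + 4 * r) * b\<close>, both terms of the exponent are multiples of
  \<open>b / 2\<close>, with factors \<open>1 + r\<close> and
  \<open>2 * d * (r^2 + 4 * r)\<close>.\<close>

lemma xi_const_eq:
  assumes "\<sigma> > 0"
  shows "xi_const r d \<sigma> = exp (b_const r \<sigma> / 2 * (1 + r) + d * \<sigma>\<^sup>2 * (b_const r \<sigma>)\<^sup>2)"
proof -
  have "\<sigma>\<^sup>2 * (b_const r \<sigma>)\<^sup>2 = (r\<^sup>2 + 4 * r) * b_const r \<sigma>"
    using assms by (simp add: b_const_def power2_eq_square)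
  then have "b_const r \<sigma> / 2 * (1 + r) + d * \<sigma>\<^sup>2 * (b_const r \<sigma>)\<^sup>2
      = b_const r \<sigma> / 2 * (1 + r) + d * (r\<^sup>2 + 4 * r) * b_const r \<sigma>" by (simp add: mult.assoc)
  also have "\<dots> = b_const r \<sigma> * (2 * d * r\<^sup>2 + (8 * d + 1) * r + 1) / 2"
    by (simp add: field_simps)
  finally show ?thesis by (simp add: xi_const_def b_const_def)
qed

text \<open>One function in two roles: the growth bound in \<open>admissible\<close> and the bound
  on the log-ratio of smoothed densities. Their coincidence puts the optimal test function into the
  class.\<close>

definition log_ratio_bound :: "real \<Rightarrow> real \<Rightarrow> 'a::euclidean_space \<Rightarrow> real" where
  "log_ratio_bound r \<sigma> y = b_const r \<sigma> / 2 * (1 + norm y)"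

lemma log_ratio_bound_measurable [measurable]: "log_ratio_bound r \<sigma> \<in> borel_measurable borel"
  unfolding log_ratio_bound_def by measurable

lemma log_ratio_bound_nonneg: "0 \<le> r \<Longrightarrow> 0 \<le> log_ratio_bound r \<sigma> y"
  by (simp add: log_ratio_bound_def b_const_def)

lemma exp_log_ratio_gauss:
  fixes x :: "'a::euclidean_space"
  assumes "\<sigma> > 0" "0 \<le> r" "norm x \<le> r"
  shows "integrable lborel (\<lambda>y. exp (log_ratio_bound r \<sigma> y) * gauss_dens \<sigma> (x - y))"
    and "(\<integral>y. exp (log_ratio_bound r \<sigma> y) * gauss_dens \<sigma> (x - y) \<partial>lborel) \<le> 2 * xi_const r (real DIM('a)) \<sigma>"
proof -
  have b: "0 \<le> b_const r \<sigma>" using assms by (simp add: b_const_def)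
  have le: "(\<integral>\<^sup>+y. ennreal (exp (log_ratio_bound r \<sigma> y) * gauss_dens \<sigma> (x - y)) \<partial>lborel)
      \<le> ennreal (2 * xi_const r (real DIM('a)) \<sigma>)"
    unfolding log_ratio_bound_def xi_const_eq[OF assms(1)]
    by (rule nn_integral_exp_gauss_shift_le[OF assms(1) b assms(3)])
  show int: "integrable lborel (\<lambda>y. exp (log_ratio_bound r \<sigma> y) * gauss_dens \<sigma> (x - y))"
    by (rule integrableI_nonneg) (use le in \<open>auto simp: gauss_dens_nonneg less_top[symmetric] top_unique\<close>)
  have "ennreal (\<integral>y. exp (log_ratio_bound r \<sigma> y) * gauss_dens \<sigma> (x - y) \<partial>lborel) \<le> ennreal (2 * xi_const r (real DIM('a)) \<sigma>)"
    by (subst nn_integral_eq_integral[symmetric, OF int]) (use le in \<open>auto simp: gauss_dens_nonneg\<close>)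
  then show "(\<integral>y. exp (log_ratio_bound r \<sigma> y) * gauss_dens \<sigma> (x - y) \<partial>lborel) \<le> 2 * xi_const r (real DIM('a)) \<sigma>"
    by (subst (asm) ennreal_le_iff) (auto simp: xi_const_def)
qed

lemma integral_gauss_shift:
  fixes x :: "'a::euclidean_space"
  shows "(\<integral>y. gauss_dens \<sigma> (x - y) \<partial>lborel) = (\<integral>y. gauss_dens \<sigma> (y::'a) \<partial>lborel)"
proof -
  have "lborel = distr lborel borel (\<lambda>y::'a. x - y)"
    using lborel_affine[of "-1" x] by (simp add: density_1)
  then have "(\<integral>y. gauss_dens \<sigma> (y::'a) \<partial>lborel) = (\<integral>y. gauss_dens \<sigma> y \<partial>distr lborel borel (\<lambda>y. x - y))"
    by (rule arg_cong)
  then show ?thesis by (simp add: integral_distr)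
qed

section \<open>Pointwise bounds on Gaussian mixtures\<close>

text \<open>Stated for a random centre \<open>Z\<close> to cover both \<open>\<mu>\<close> (with
  \<open>Z\<close> the identity) and the empirical measure (with a uniform index and
  \<open>Z = X\<close>). It holds because \<open>(norm (y - z))^2\<close> lies between
  \<open>(norm y)^2 - 2 * r * norm y\<close> and \<open>(norm y)^2 + 2 * r * norm y + r^2\<close>
  for every centre in the ball.\<close>

lemma (in prob_space) gauss_mixture_bounds:
  fixes Z :: "'a \<Rightarrow> 'b::euclidean_space" and y :: 'b and r :: real
  assumes "\<sigma> > 0" "0 \<le> r" and Z [measurable]: "random_variable borel Z" and "AE x in M. norm (Z x) \<le> r"
  defines "g \<equiv> (\<lambda>y. \<integral>x. gauss_dens \<sigma> (y - Z x) \<partial>M)"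
  shows "gauss_dens \<sigma> y * exp (- (2 * r * norm y + r\<^sup>2) / (2 * \<sigma>\<^sup>2)) \<le> g y"
    and "g y \<le> gauss_dens \<sigma> y * exp (2 * r * norm y / (2 * \<sigma>\<^sup>2))"
proof -
  let ?c = "(2 * pi * \<sigma>\<^sup>2) powr (- real DIM('b) / 2)"
  have pt: "gauss_dens \<sigma> y * exp (- (2 * r * norm y + r\<^sup>2) / (2 * \<sigma>\<^sup>2)) \<le> gauss_dens \<sigma> (y - z)"
      "gauss_dens \<sigma> (y - z) \<le> gauss_dens \<sigma> y * exp (2 * r * norm y / (2 * \<sigma>\<^sup>2))" if z: "norm z \<le> r" for z
  proof -
    have "\<bar>y \<bullet> z\<bar> \<le> norm y * norm z" by (rule Cauchy_Schwarz_ineq2)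
    also have "\<dots> \<le> norm y * r" using z by (rule mult_left_mono) simp
    finally have yz: "\<bar>y \<bullet> z\<bar> \<le> r * norm y" by (simp add: mult.commute)
    have z2: "(norm z)\<^sup>2 \<le> r\<^sup>2" using z by (intro power_mono) auto
    have sq: "(norm (y - z))\<^sup>2 = (norm y)\<^sup>2 - 2 * (y \<bullet> z) + (norm z)\<^sup>2"
      by (simp add: power2_norm_eq_inner inner_diff_left inner_diff_right inner_commute)
    have "- (norm y)\<^sup>2 + - (2 * r * norm y + r\<^sup>2) \<le> - (norm (y - z))\<^sup>2"
      using yz z2 unfolding sq by linarith
    then have "- (norm y)\<^sup>2 / (2 * \<sigma>\<^sup>2) + - (2 * r * norm y + r\<^sup>2) / (2 * \<sigma>\<^sup>2) \<le> - (norm (y - z))\<^sup>2 / (2 * \<sigma>\<^sup>2)"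
      unfolding add_divide_distrib[symmetric] by (rule divide_right_mono) simp
    then have "exp (- (norm y)\<^sup>2 / (2 * \<sigma>\<^sup>2)) * exp (- (2 * r * norm y + r\<^sup>2) / (2 * \<sigma>\<^sup>2)) \<le> exp (- (norm (y - z))\<^sup>2 / (2 * \<sigma>\<^sup>2))"
      unfolding exp_add[symmetric] exp_le_cancel_iff .
    then have "?c * (exp (- (norm y)\<^sup>2 / (2 * \<sigma>\<^sup>2)) * exp (- (2 * r * norm y + r\<^sup>2) / (2 * \<sigma>\<^sup>2))) \<le> ?c * exp (- (norm (y - z))\<^sup>2 / (2 * \<sigma>\<^sup>2))"
      by (rule mult_left_mono) simp
    then show "gauss_dens \<sigma> y * exp (- (2 * r * norm y + r\<^sup>2) / (2 * \<sigma>\<^sup>2)) \<le> gauss_dens \<sigma> (y - z)"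
      unfolding gauss_dens_def mult.assoc .
    have "- (norm (y - z))\<^sup>2 \<le> - (norm y)\<^sup>2 + 2 * r * norm y"
      using yz zero_le_power2[of "norm z"] unfolding sq by linarith
    then have "- (norm (y - z))\<^sup>2 / (2 * \<sigma>\<^sup>2) \<le> - (norm y)\<^sup>2 / (2 * \<sigma>\<^sup>2) + 2 * r * norm y / (2 * \<sigma>\<^sup>2)"
      unfolding add_divide_distrib[symmetric] by (rule divide_right_mono) simp
    then have "exp (- (norm (y - z))\<^sup>2 / (2 * \<sigma>\<^sup>2)) \<le> exp (- (norm y)\<^sup>2 / (2 * \<sigma>\<^sup>2)) * exp (2 * r * norm y / (2 * \<sigma>\<^sup>2))"
      unfolding exp_add[symmetric] exp_le_cancel_iff .
    then have "?c * exp (- (norm (y - z))\<^sup>2 / (2 * \<sigma>\<^sup>2)) \<le> ?c * (exp (- (norm y)\<^sup>2 / (2 * \<sigma>\<^sup>2)) * exp (2 * r * norm y / (2 * \<sigma>\<^sup>2)))"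
      by (rule mult_left_mono) simp
    then show "gauss_dens \<sigma> (y - z) \<le> gauss_dens \<sigma> y * exp (2 * r * norm y / (2 * \<sigma>\<^sup>2))"
      unfolding gauss_dens_def mult.assoc .
  qed
  have ae: "AE x in M. gauss_dens \<sigma> y * exp (- (2 * r * norm y + r\<^sup>2) / (2 * \<sigma>\<^sup>2)) \<le> gauss_dens \<sigma> (y - Z x)"
      "AE x in M. gauss_dens \<sigma> (y - Z x) \<le> gauss_dens \<sigma> y * exp (2 * r * norm y / (2 * \<sigma>\<^sup>2))"
    by (rule eventually_mono[OF assms(4)], erule pt)+
  have int: "integrable M (\<lambda>x. gauss_dens \<sigma> (y - Z x))"
    by (rule integrable_const_bound[where B = "gauss_dens \<sigma> y * exp (2 * r * norm y / (2 * \<sigma>\<^sup>2))"])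
       (use ae(2) in \<open>simp_all add: gauss_dens_nonneg\<close>)
  show "gauss_dens \<sigma> y * exp (- (2 * r * norm y + r\<^sup>2) / (2 * \<sigma>\<^sup>2)) \<le> g y"
    unfolding g_def by (intro integral_ge_const int ae)
  show "g y \<le> gauss_dens \<sigma> y * exp (2 * r * norm y / (2 * \<sigma>\<^sup>2))"
    unfolding g_def by (intro integral_le_const int ae)
qed

text \<open>Both densities lie between multiples of the same Gaussian, whose logarithm cancels in
  the ratio.\<close>

lemma ln_ratio_gauss_bounds:
  fixes y :: "'a::euclidean_space"
  assumes "\<sigma> > 0" "0 \<le> r"
    and p: "gauss_dens \<sigma> y * exp (- (2 * r * norm y + r\<^sup>2) / (2 * \<sigma>\<^sup>2)) \<le> p"
       "p \<le> gauss_dens \<sigma> y * exp (2 * r * norm y / (2 * \<sigma>\<^sup>2))"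
    and q: "gauss_dens \<sigma> y * exp (- (2 * r * norm y + r\<^sup>2) / (2 * \<sigma>\<^sup>2)) \<le> q"
       "q \<le> gauss_dens \<sigma> y * exp (2 * r * norm y / (2 * \<sigma>\<^sup>2))"
  shows "0 < p" "0 < q" "\<bar>ln (p / q)\<bar> \<le> log_ratio_bound r \<sigma> y"
proof -
  have g: "0 < gauss_dens \<sigma> y" using assms(1) by (simp add: gauss_dens_pos)
  have lb: "0 < gauss_dens \<sigma> y * exp (- (2 * r * norm y + r\<^sup>2) / (2 * \<sigma>\<^sup>2))" using g by simp
  show p0: "0 < p" and q0: "0 < q" using lb p q by linarith+
  have *: "ln (gauss_dens \<sigma> y) - (2 * r * norm y + r\<^sup>2) / (2 * \<sigma>\<^sup>2) \<le> ln t \<and>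
      ln t \<le> ln (gauss_dens \<sigma> y) + 2 * r * norm y / (2 * \<sigma>\<^sup>2)"
    if "0 < t" "gauss_dens \<sigma> y * exp (- (2 * r * norm y + r\<^sup>2) / (2 * \<sigma>\<^sup>2)) \<le> t"
       "t \<le> gauss_dens \<sigma> y * exp (2 * r * norm y / (2 * \<sigma>\<^sup>2))" for t
  proof -
    have "ln (gauss_dens \<sigma> y * exp (- (2 * r * norm y + r\<^sup>2) / (2 * \<sigma>\<^sup>2))) \<le> ln t"
      using lb that by (subst ln_le_cancel_iff) auto
    moreover have "ln t \<le> ln (gauss_dens \<sigma> y * exp (2 * r * norm y / (2 * \<sigma>\<^sup>2)))"
      using that g by (subst ln_le_cancel_iff) auto
    ultimately show ?thesis using g
      by (simp only: ln_mult_pos[OF g exp_gt_zero] ln_exp minus_divide_left[symmetric]) simp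
  qed
  have "\<bar>ln (p / q)\<bar> \<le> (2 * r * norm y + r\<^sup>2) / (2 * \<sigma>\<^sup>2) + 2 * r * norm y / (2 * \<sigma>\<^sup>2)"
    using *[OF p0 p] *[OF q0 q] p0 q0 by (simp only: ln_divide_pos abs_le_iff) linarith
  also have "\<dots> = (4 * r * norm y + r\<^sup>2) / (2 * \<sigma>\<^sup>2)" unfolding add_divide_distrib[symmetric] by simp
  \<comment> \<open>Origin of the numerator of \<open>b_const\<close>: \<open>4 * r\<close> comes
    from the growing part and \<open>r^2\<close> from the constant part, merged into one coefficient
    of \<open>1 + norm y\<close>.\<close>
  also have "\<dots> \<le> ((r\<^sup>2 + 4 * r) * (1 + norm y)) / (2 * \<sigma>\<^sup>2)"
    using assms(2) by (intro divide_right_mono) (auto simp: algebra_simps)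
  also have "\<dots> = log_ratio_bound r \<sigma> y" by (simp add: log_ratio_bound_def b_const_def)
  finally show "\<bar>ln (p / q)\<bar> \<le> log_ratio_bound r \<sigma> y" .
qed

section \<open>Kullback-Leibler divergence of smoothed densities\<close>

text \<open>The log-ratio is at most \<open>h\<close>, hence at most \<open>exp h\<close>, whose
  integral against \<open>p\<close> is finite; this rules out the infinite branch of
  \<open>KL_lborel\<close>.\<close>

lemma KL_lborel_eq:
  fixes p q h :: "'a::euclidean_space \<Rightarrow> real"
  assumes "p \<in> borel_measurable borel" "q \<in> borel_measurable borel"
    and "\<And>y. 0 < p y" "\<And>y. 0 < q y" "\<And>y. \<bar>ln (p y / q y)\<bar> \<le> h y"
    and "integrable lborel (\<lambda>y. exp (h y) * p y)"
  shows "integrable lborel (\<lambda>y. p y * ln (p y / q y))"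
    and "KL_lborel p q = ereal (\<integral>y. p y * ln (p y / q y) \<partial>lborel)"
proof -
  show int: "integrable lborel (\<lambda>y. p y * ln (p y / q y))"
  proof (rule Bochner_Integration.integrable_bound[OF assms(6)])
    show "(\<lambda>y. p y * ln (p y / q y)) \<in> borel_measurable lborel" using assms(1,2) by measurable
    have "\<bar>p y * ln (p y / q y)\<bar> \<le> exp (h y) * p y" for y
      using order_trans[OF assms(5)[of y] order_trans[OF _ exp_ge_add_one_self[of "h y"]]] assms(3)[of y]
      by (simp add: abs_mult mult.commute)
    then show "AE y in lborel. norm (p y * ln (p y / q y)) \<le> norm (exp (h y) * p y)"
      by (intro AE_I2) (auto intro: order_trans[OF _ abs_ge_self])
  qed
  show "KL_lborel p q = ereal (\<integral>y. p y * ln (p y / q y) \<partial>lborel)"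
    using int less_imp_neq[OF assms(4), THEN not_sym] by (simp add: KL_lborel_def)
qed

text \<open>Donsker--Varadhan: \<open>p * ln (p / q) \<ge> f * p - exp f * q + p\<close> pointwise, with equality for
  \<open>f = ln (p / q)\<close>; testing \<open>KL p q\<close> with the optimal \<open>f\<close> for \<open>KL p' q'\<close> linearizes the difference.\<close>

lemma KL_diff_le:
  fixes p q p' q' h :: "'a::euclidean_space \<Rightarrow> real"
  assumes [measurable]: "p \<in> borel_measurable borel" "q \<in> borel_measurable borel"
      "p' \<in> borel_measurable borel" "q' \<in> borel_measurable borel"
    and pos: "\<And>y. 0 < p y" "\<And>y. 0 < q y" "\<And>y. 0 < p' y" "\<And>y. 0 < q' y"
    and h: "\<And>y. \<bar>ln (p y / q y)\<bar> \<le> h y" "\<And>y. \<bar>ln (p' y / q' y)\<bar> \<le> h y"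
    and int: "integrable lborel (\<lambda>y. exp (h y) * p y)" "integrable lborel (\<lambda>y. exp (h y) * q y)"
      "integrable lborel (\<lambda>y. exp (h y) * p' y)" "integrable lborel (\<lambda>y. exp (h y) * q' y)"
    and mass: "(\<integral>y. p y \<partial>lborel) = (\<integral>y. p' y \<partial>lborel)"
  defines "f \<equiv> (\<lambda>y. ln (p' y / q' y))"
  shows "(\<integral>y. p' y * ln (p' y / q' y) \<partial>lborel) - (\<integral>y. p y * ln (p y / q y) \<partial>lborel)
    \<le> (\<integral>y. f y * (p' y - p y) \<partial>lborel) - (\<integral>y. exp (f y) * (q' y - q y) \<partial>lborel)"
proof -
  have [measurable]: "f \<in> borel_measurable borel" unfolding f_def by measurable
  have bnd: "integrable lborel (\<lambda>y. k y * g y)"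
    if "integrable lborel (\<lambda>y. exp (h y) * g y)" "\<And>y. 0 < g y" "\<And>y. \<bar>k y\<bar> \<le> exp (h y)"
      "g \<in> borel_measurable borel" "k \<in> borel_measurable borel" for k g
    using that
    by (intro Bochner_Integration.integrable_bound[OF that(1)])
       (auto simp: abs_mult less_imp_le intro!: AE_I2 mult_right_mono)
  have h0: "0 \<le> h y" for y using h(1)[of y] by linarith
  have fh: "\<bar>f y\<bar> \<le> exp (h y)" for y
    using h(2)[of y] exp_ge_add_one_self[of "h y"] unfolding f_def by linarith
  have efh: "\<bar>exp (f y)\<bar> \<le> exp (h y)" for y
    using h(2)[of y] unfolding f_def by (simp add: abs_le_iff)
  have eh1: "\<bar>1\<bar> \<le> exp (h y)" for y using h0 by simp
  have i: "integrable lborel (\<lambda>y. f y * p y)" "integrable lborel (\<lambda>y. f y * p' y)"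
      "integrable lborel (\<lambda>y. exp (f y) * q y)" "integrable lborel (\<lambda>y. exp (f y) * q' y)"
    using fh efh pos int by (auto intro!: bnd)
  have ip: "integrable lborel p"
    using bnd[OF int(1) pos(1) eh1] by simp
  have "(\<integral>y. f y * p y - exp (f y) * q y + p y \<partial>lborel) \<le> (\<integral>y. p y * ln (p y / q y) \<partial>lborel)"
  proof (rule integral_mono)
    fix y
    \<comment> \<open>\<open>ln u \<le> u - 1\<close> at \<open>u = exp f * q / p\<close>,
      multiplied by \<open>p\<close>, is the pointwise variational inequality.\<close>
    have "ln (exp (f y) * q y / p y) \<le> exp (f y) * q y / p y - 1"
      using pos by (intro ln_le_minus_one) auto
    moreover have "ln (exp (f y) * q y / p y) = f y - ln (p y / q y)"
      using pos[of y] by (simp add: ln_mult ln_div)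
    ultimately have "p y * (f y - ln (p y / q y)) \<le> p y * (exp (f y) * q y / p y - 1)"
      using pos(1)[of y] by (intro mult_left_mono) auto
    also have "\<dots> = exp (f y) * q y - p y" using pos(1)[of y] by (simp add: field_simps)
    finally show "f y * p y - exp (f y) * q y + p y \<le> p y * ln (p y / q y)" by (simp add: algebra_simps)
  qed (use i ip KL_lborel_eq(1)[OF _ _ pos(1,2) h(1) int(1)] in auto)
  moreover have "(\<integral>y. f y * p y - exp (f y) * q y + p y \<partial>lborel)
      = (\<integral>y. f y * p y \<partial>lborel) - (\<integral>y. exp (f y) * q y \<partial>lborel) + (\<integral>y. p y \<partial>lborel)"
    using i ip by simp
  moreover have "(\<integral>y. p' y * ln (p' y / q' y) \<partial>lborel) = (\<integral>y. f y * p' y \<partial>lborel)"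
    by (simp add: f_def mult.commute)
  \<comment> \<open>Equality case: \<open>f\<close> is optimal for the primed pair, so this term is
    the mass of \<open>p'\<close>, which cancels the mass of \<open>p\<close> by
    \<open>mass\<close>.\<close>
  moreover have "(\<integral>y. exp (f y) * q' y \<partial>lborel) = (\<integral>y. p' y \<partial>lborel)"
  proof -
    have "exp (f y) * q' y = p' y" for y using pos(3,4)[of y] by (simp add: f_def)
    then show ?thesis by simp
  qed
  ultimately show ?thesis using i mass by (simp add: right_diff_distrib)
qed

text \<open>The cutoff makes the kernel uniformly integrable in \<open>x\<close>, so that the deviations are
  bounded everywhere; samples of measures in \<open>prob_ball r\<close> almost surely do not see it.\<close>

definition ball_kernel :: "real \<Rightarrow> real \<Rightarrow> 'a::euclidean_space \<Rightarrow> 'a \<Rightarrow> real" where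
  "ball_kernel r \<sigma> x y = (if norm x \<le> r then gauss_dens \<sigma> (x - y) else 0)"

lemma ball_kernel_in: "norm x \<le> r \<Longrightarrow> ball_kernel r \<sigma> x y = gauss_dens \<sigma> (x - y)"
  by (simp add: ball_kernel_def)

section \<open>The Gaussian model as an instance of the abstract kernel\<close>

lemma prob_ballD:
  assumes "\<mu> \<in> prob_ball r"
  shows "prob_space \<mu>" "sets \<mu> = sets borel" "space \<mu> = UNIV" "AE x in \<mu>. norm x \<le> r"
proof -
  show "prob_space \<mu>" and s: "sets \<mu> = sets borel" using assms by (auto simp: prob_ball_def)
  then interpret prob_space \<mu> by simp
  show "space \<mu> = UNIV" using sets_eq_imp_space_eq[OF s] by simp
  have "prob (cball 0 r) = 1" using assms by (simp add: prob_ball_def measure_def)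
  from AE_prob_1[OF this] show "AE x in \<mu>. norm x \<le> r" by simp
qed

text \<open>The form with a random index feeds \<open>gauss_mixture_bounds\<close>, the finite
  average connects to \<open>deviation\<close>. Repeated sample points count with multiplicity in
  both.\<close>

lemma smooth_dens_empirical:
  assumes "n \<ge> 1"
  shows "smooth_dens \<sigma> (empirical n X) y = (\<integral>i. gauss_dens \<sigma> (y - X i) \<partial>measure_pmf (pmf_of_set {..<n}))"
    and "smooth_dens \<sigma> (empirical n X) y = (\<Sum>i<n. gauss_dens \<sigma> (X i - y)) / real n"
proof -
  have ne: "{..<n} \<noteq> {}" using assms by (auto simp: lessThan_empty_iff)
  show *: "smooth_dens \<sigma> (empirical n X) y = (\<integral>i. gauss_dens \<sigma> (y - X i) \<partial>measure_pmf (pmf_of_set {..<n}))"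
    using ne by (simp add: smooth_dens_def empirical_def flip: map_pmf_of_set)
  show "smooth_dens \<sigma> (empirical n X) y = (\<Sum>i<n. gauss_dens \<sigma> (X i - y)) / real n"
    unfolding * using ne by (subst integral_pmf_of_set) (simp_all add: gauss_dens_minus_commute[of \<sigma> y])
qed

text \<open>The band stays open because the locale is used twice: for \<open>\<mu>\<close> with
  \<open>- h\<close> and \<open>h\<close>, for \<open>\<nu>\<close> with \<open>exp (- h)\<close>
  and \<open>exp h\<close>.\<close>

locale gauss_sample =
  sampled_kernel \<mu> lborel "ball_kernel r \<sigma>" lo hi "\<lambda>y. exp (log_ratio_bound r \<sigma> y)" "2 * xi_const r (real DIM('a)) \<sigma>"
  for \<mu> :: "'a::euclidean_space measure" and \<sigma> r lo hi +
  assumes sigma_pos: "\<sigma> > 0" and r_nonneg: "r \<ge> 0" and mu: "\<mu> \<in> prob_ball r"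

lemma gauss_sampleI:
  fixes \<mu> :: "'a::euclidean_space measure"
  assumes "\<sigma> > 0" "r \<ge> 0" and mu: "\<mu> \<in> prob_ball r"
    and [measurable]: "lo \<in> borel_measurable borel" "hi \<in> borel_measurable borel"
    and "\<And>y. lo y \<le> hi y" "\<And>y. \<bar>lo y\<bar> \<le> exp (log_ratio_bound r \<sigma> y)" "\<And>y. \<bar>hi y\<bar> \<le> exp (log_ratio_bound r \<sigma> y)"
  shows "gauss_sample \<mu> \<sigma> r lo hi"
proof -
  interpret prob_space \<mu> using prob_ballD(1)[OF mu] .
  note [measurable_cong] = prob_ballD(2)[OF mu]
  interpret sampled_kernel \<mu> lborel "ball_kernel r \<sigma>" lo hi "\<lambda>y. exp (log_ratio_bound r \<sigma> y)" "2 * xi_const r (real DIM('a)) \<sigma>"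
  proof
    have "(\<lambda>(x, y). ball_kernel r \<sigma> x y) \<in> borel_measurable (borel \<Otimes>\<^sub>M borel)"
      unfolding ball_kernel_def by measurable
    then show "case_prod (ball_kernel r \<sigma>) \<in> borel_measurable (\<mu> \<Otimes>\<^sub>M lborel)"
      by (simp add: measurable_cong_sets[OF sets_pair_measure_cong[OF prob_ballD(2)[OF mu] sets_lborel] refl])
    show "integrable lborel (\<lambda>y. exp (log_ratio_bound r \<sigma> y) * ball_kernel r \<sigma> x y)" for x :: 'a
      using exp_log_ratio_gauss(1)[OF assms(1,2), of x] by (cases "norm x \<le> r") (auto simp: ball_kernel_def)
    show "(\<integral>y. exp (log_ratio_bound r \<sigma> y) * ball_kernel r \<sigma> x y \<partial>lborel) \<le> 2 * xi_const r (real DIM('a)) \<sigma>" for x :: 'a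
      using exp_log_ratio_gauss(2)[OF assms(1,2), of x]
      by (cases "norm x \<le> r") (auto simp: ball_kernel_def xi_const_def)
  qed (use assms in \<open>auto simp: ball_kernel_def gauss_dens_nonneg\<close>)
  show ?thesis by unfold_locales (use assms in auto)
qed

context gauss_sample
begin

lemmas mu_space [simp] = prob_ballD(3)[OF mu]
lemmas mu_sets [measurable_cong] = prob_ballD(2)[OF mu]

lemma mean_eq: "mean y = smooth_dens \<sigma> \<mu> y"
  unfolding mean_def smooth_dens_def
  by (rule integral_cong_AE, measurable)
     (use prob_ballD(4)[OF mu] in \<open>auto simp: ball_kernel_def gauss_dens_minus_commute[of \<sigma> y] eventually_mono\<close>)

lemma smooth_dens_meas [measurable]: "smooth_dens \<sigma> \<mu> \<in> borel_measurable borel"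
proof -
  have "mean = smooth_dens \<sigma> \<mu>" by (auto simp: mean_eq)
  then show ?thesis using mean_meas by simp
qed

lemma smooth_dens_weighted: "weighted (smooth_dens \<sigma> \<mu>)"
proof -
  have "mean = smooth_dens \<sigma> \<mu>" by (auto simp: mean_eq)
  then show ?thesis using weighted_mean by simp
qed

text \<open>Puts the constant 1 under the majorant, so that the results on dominated test functions
  also yield total masses.\<close>

lemma one_le: "\<bar>1\<bar> \<le> exp (log_ratio_bound r \<sigma> y)"
  using log_ratio_bound_nonneg[OF r_nonneg, of \<sigma> y] by simp

lemma integral_ball_kernel:
  "norm (x::'a) \<le> r \<Longrightarrow> (\<integral>y. ball_kernel r \<sigma> x y \<partial>lborel) = (\<integral>y. gauss_dens \<sigma> (y::'a) \<partial>lborel)"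
  by (simp add: ball_kernel_in integral_gauss_shift)

lemma integral_smooth_dens: "(\<integral>y. smooth_dens \<sigma> \<mu> y \<partial>lborel) = (\<integral>y. gauss_dens \<sigma> (y::'a) \<partial>lborel)"
proof -
  have "(\<integral>y. smooth_dens \<sigma> \<mu> y \<partial>lborel) = (\<integral>x. (\<integral>y. ball_kernel r \<sigma> x y \<partial>lborel) \<partial>\<mu>)"
    using integral_mean(1)[of "\<lambda>_. 1", OF _ one_le] by (simp add: mean_eq)
  also have "\<dots> = (\<integral>x. (\<integral>y. gauss_dens \<sigma> (y::'a) \<partial>lborel) \<partial>\<mu>)"
    by (rule integral_cong_AE, measurable)
       (use prob_ballD(4)[OF mu] in \<open>auto simp: integral_ball_kernel elim: eventually_mono\<close>)
  finally show ?thesis using prob_space by simp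
qed

lemma smooth_dens_bounds:
  shows "gauss_dens \<sigma> y * exp (- (2 * r * norm y + r\<^sup>2) / (2 * \<sigma>\<^sup>2)) \<le> smooth_dens \<sigma> \<mu> y"
    and "smooth_dens \<sigma> \<mu> y \<le> gauss_dens \<sigma> y * exp (2 * r * norm y / (2 * \<sigma>\<^sup>2))"
  unfolding smooth_dens_def
  by (rule gauss_mixture_bounds; use sigma_pos r_nonneg prob_ballD(4)[OF mu] in simp; fail)+

context
  fixes n :: nat and X :: "nat \<Rightarrow> 'a"
  assumes n: "n \<ge> 1" and X: "\<forall>i<n. norm (X i) \<le> r"
begin

lemma empirical_eq: "smooth_dens \<sigma> (empirical n X) y = 1 / real n * (\<Sum>i<n. ball_kernel r \<sigma> (X i) y)"
  using X by (simp add: smooth_dens_empirical(2)[OF n] ball_kernel_in)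

lemma empirical_meas [measurable]: "smooth_dens \<sigma> (empirical n X) \<in> borel_measurable borel"
  unfolding smooth_dens_empirical(2)[OF n] by measurable

lemma empirical_weighted: "weighted (smooth_dens \<sigma> (empirical n X))"
  unfolding empirical_eq[abs_def] by (intro weighted_cmult weighted_sum weighted_K) simp

lemma integral_empirical: "(\<integral>y. smooth_dens \<sigma> (empirical n X) y \<partial>lborel) = (\<integral>y. gauss_dens \<sigma> (y::'a) \<partial>lborel)"
proof -
  have "integrable lborel (\<lambda>y. ball_kernel r \<sigma> x y)" for x :: 'a
    using weighted_int[OF weighted_K[of x], where k = "\<lambda>_. 1", OF _ _ one_le] by simp
  then show ?thesis
    using X n by (simp add: empirical_eq integral_ball_kernel)
qed

lemma empirical_bounds:
  shows "gauss_dens \<sigma> y * exp (- (2 * r * norm y + r\<^sup>2) / (2 * \<sigma>\<^sup>2)) \<le> smooth_dens \<sigma> (empirical n X) y"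
    and "smooth_dens \<sigma> (empirical n X) y \<le> gauss_dens \<sigma> y * exp (2 * r * norm y / (2 * \<sigma>\<^sup>2))"
proof -
  have ne: "{..<n} \<noteq> {}" using n by (auto simp: lessThan_empty_iff)
  have ae: "AE i in measure_pmf (pmf_of_set {..<n}). norm (X i) \<le> r"
    using X ne by (simp add: AE_measure_pmf_iff set_pmf_of_set)
  note * = prob_space.gauss_mixture_bounds[OF measure_pmf.prob_space_axioms sigma_pos r_nonneg _ ae]
  show "gauss_dens \<sigma> y * exp (- (2 * r * norm y + r\<^sup>2) / (2 * \<sigma>\<^sup>2)) \<le> smooth_dens \<sigma> (empirical n X) y"
    unfolding smooth_dens_empirical(1)[OF n] by (rule *) simp
  show "smooth_dens \<sigma> (empirical n X) y \<le> gauss_dens \<sigma> y * exp (2 * r * norm y / (2 * \<sigma>\<^sup>2))"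
    unfolding smooth_dens_empirical(1)[OF n] by (rule *) simp
qed

lemma integral_diff_le_deviation:
  assumes "k \<in> borel_measurable lborel" "\<And>y. lo y \<le> k y" "\<And>y. k y \<le> hi y"
  shows "\<bar>\<integral>y. k y * (smooth_dens \<sigma> (empirical n X) y - smooth_dens \<sigma> \<mu> y) \<partial>lborel\<bar> \<le> deviation {..<n} X / real n"
proof -
  have eq: "smooth_dens \<sigma> (empirical n X) y - smooth_dens \<sigma> \<mu> y = 1 / real n * (\<Sum>i<n. ball_kernel r \<sigma> (X i) y - mean y)" for y
    using n by (simp add: empirical_eq mean_eq sum_subtractf field_simps)
  have "(\<integral>y. k y * (smooth_dens \<sigma> (empirical n X) y - smooth_dens \<sigma> \<mu> y) \<partial>lborel)
      = 1 / real n * (\<integral>y. k y * (\<Sum>i<n. ball_kernel r \<sigma> (X i) y - mean y) \<partial>lborel)"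
    unfolding eq by (simp add: mult.left_commute)
  also have "\<bar>\<dots>\<bar> = \<bar>\<integral>y. k y * (\<Sum>i<n. ball_kernel r \<sigma> (X i) y - mean y) \<partial>lborel\<bar> / real n"
    by (simp add: abs_mult)
  also have "\<dots> \<le> deviation {..<n} X / real n"
    unfolding deviation_def using assms by (intro divide_right_mono abs_integral_le_env) auto
  finally show ?thesis .
qed

text \<open>For each sign vector the extremal \<open>k\<close> gives a member of \<open>G\<close>
  attaining \<open>env\<close>, by linearity of the integral. Since \<open>rad_avg\<close> stands on
  the smaller side of the inequality defining the event, this direction is the one required.\<close>

lemma rademacher_le_rad_avg:
  assumes G: "\<And>k. k \<in> borel_measurable borel \<Longrightarrow> (\<And>y. lo y \<le> k y) \<Longrightarrow> (\<And>y. k y \<le> hi y) \<Longrightarrow> conv_gauss \<sigma> k \<in> G"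
  shows "ereal (rademacher {..<n} X) \<le> rad_avg n G X"
proof -
  have Xsp: "X i \<in> space \<mu>" for i by simp
  have *: "ereal (env (\<lambda>y. \<Sum>i<n. \<epsilon> i * ball_kernel r \<sigma> (X i) y)) \<le> (SUP g\<in>G. ereal \<bar>\<Sum>i<n. \<epsilon> i * g (X i)\<bar>)" for \<epsilon>
  proof -
    have "weighted (\<lambda>y. \<Sum>i<n. \<epsilon> i * ball_kernel r \<sigma> (X i) y)" by auto
    then obtain k where k: "k \<in> borel_measurable lborel" "\<And>y. lo y \<le> k y" "\<And>y. k y \<le> hi y"
      and e: "env (\<lambda>y. \<Sum>i<n. \<epsilon> i * ball_kernel r \<sigma> (X i) y) = \<bar>\<integral>y. k y * (\<Sum>i<n. \<epsilon> i * ball_kernel r \<sigma> (X i) y) \<partial>lborel\<bar>"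
      by (rule env_attained) (rule that, auto)
    have kH: "\<bar>k y\<bar> \<le> exp (log_ratio_bound r \<sigma> y)" for y
      using k(2,3)[of y] lo_H[of y] hi_H[of y] by linarith
    have "integrable lborel (\<lambda>y. k y * ball_kernel r \<sigma> (X i) y)" for i
      using k(1) kH by (intro weighted_int weighted_K) auto
    then have "(\<integral>y. k y * (\<Sum>i<n. \<epsilon> i * ball_kernel r \<sigma> (X i) y) \<partial>lborel) = (\<Sum>i<n. \<epsilon> i * (\<integral>y. k y * ball_kernel r \<sigma> (X i) y \<partial>lborel))"
      by (simp add: sum_distrib_left mult.left_commute[of "k _"])
    also have "\<dots> = (\<Sum>i<n. \<epsilon> i * conv_gauss \<sigma> k (X i))"
      using X by (simp add: conv_gauss_def ball_kernel_in)
    finally have "env (\<lambda>y. \<Sum>i<n. \<epsilon> i * ball_kernel r \<sigma> (X i) y) = \<bar>\<Sum>i<n. \<epsilon> i * conv_gauss \<sigma> k (X i)\<bar>"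
      using e by simp
    moreover have "conv_gauss \<sigma> k \<in> G" using k by (intro G) auto
    ultimately show ?thesis by (auto intro: SUP_upper2)
  qed
  have "ereal (rademacher {..<n} X) = ereal (1 / 2 ^ n) *
     (\<Sum>\<epsilon>\<in>PiE {..<n} (\<lambda>_. {-1::real, 1}). ereal (env (\<lambda>y. \<Sum>i<n. \<epsilon> i * ball_kernel r \<sigma> (X i) y)))"
    by (simp add: rademacher_def power_one_over)
  also have "\<dots> \<le> rad_avg n G X"
    unfolding rad_avg_def by (intro ereal_mult_left_mono sum_mono *) auto
  finally show ?thesis .
qed

end

end

section \<open>From the divergence error to deviations\<close>

lemma admissible_iff:
  "admissible (b_const r \<sigma>) f \<longleftrightarrow> f \<in> borel_measurable borel \<and> (\<forall>y. \<bar>f y\<bar> \<le> log_ratio_bound r \<sigma> y)"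
  by (simp add: admissible_def log_ratio_bound_def)

text \<open>The variational bound is applied in both directions, with the log-ratio of the empirical
  pair and with that of the true pair as test function. Both are bounded by \<open>h\<close>, so
  they and their exponentials lie in the two bands.\<close>

lemma KL_diff_le_deviation:
  fixes \<mu> \<nu> :: "'a::euclidean_space measure" and n :: nat and \<sigma> r :: real
  defines "h \<equiv> log_ratio_bound r \<sigma>"
  assumes F: "gauss_sample \<mu> \<sigma> r (\<lambda>y. - h y) h"
    and E: "gauss_sample \<nu> \<sigma> r (\<lambda>y. exp (- h y)) (\<lambda>y. exp (h y))"
    and n: "n \<ge> 1" and X: "\<forall>i<n. norm (X i) \<le> r" and Y: "\<forall>i<n. norm (Y i) \<le> r"
  shows "\<bar>KL_lborel (smooth_dens \<sigma> (empirical n X)) (smooth_dens \<sigma> (empirical n Y))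
            - KL_lborel (smooth_dens \<sigma> \<mu>) (smooth_dens \<sigma> \<nu>)\<bar>
    \<le> ereal ((sampled_kernel.deviation \<mu> lborel (ball_kernel r \<sigma>) (\<lambda>y. - h y) h {..<n} X
        + sampled_kernel.deviation \<nu> lborel (ball_kernel r \<sigma>) (\<lambda>y. exp (- h y)) (\<lambda>y. exp (h y)) {..<n} Y) / real n)"
proof -
  interpret F: gauss_sample \<mu> \<sigma> r "\<lambda>y. - h y" "h" by (rule F)
  interpret E: gauss_sample \<nu> \<sigma> r "\<lambda>y. exp (- h y)" "\<lambda>y. exp (h y)" by (rule E)
  define p where "p = smooth_dens \<sigma> \<mu>"
  define q where "q = smooth_dens \<sigma> \<nu>"
  define p' where "p' = smooth_dens \<sigma> (empirical n X)"
  define q' where "q' = smooth_dens \<sigma> (empirical n Y)"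
  note defs = p_def q_def p'_def q'_def
  have meas [measurable]: "p \<in> borel_measurable borel" "q \<in> borel_measurable borel"
      "p' \<in> borel_measurable borel" "q' \<in> borel_measurable borel"
    unfolding defs
    by (rule F.smooth_dens_meas E.smooth_dens_meas F.empirical_meas[OF n X] E.empirical_meas[OF n Y])+
  note bds = F.smooth_dens_bounds E.smooth_dens_bounds F.empirical_bounds[OF n X] E.empirical_bounds[OF n Y]
  note pq = ln_ratio_gauss_bounds[OF F.sigma_pos F.r_nonneg bds(1-4), folded defs]
  note pq' = ln_ratio_gauss_bounds[OF F.sigma_pos F.r_nonneg bds(5-8), folded defs]
  have int: "integrable lborel (\<lambda>y. exp (log_ratio_bound r \<sigma> y) * p y)" "integrable lborel (\<lambda>y. exp (log_ratio_bound r \<sigma> y) * q y)"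
      "integrable lborel (\<lambda>y. exp (log_ratio_bound r \<sigma> y) * p' y)" "integrable lborel (\<lambda>y. exp (log_ratio_bound r \<sigma> y) * q' y)"
    using F.smooth_dens_weighted E.smooth_dens_weighted F.empirical_weighted[OF n X] E.empirical_weighted[OF n Y]
    by (simp_all add: F.weighted_def E.weighted_def defs)
  have mass: "(\<integral>y. p y \<partial>lborel) = (\<integral>y. p' y \<partial>lborel)"
    unfolding defs using F.integral_smooth_dens F.integral_empirical[OF n X] by simp
  have dev: "\<bar>\<integral>y. f y * (p' y - p y) \<partial>lborel\<bar> \<le> F.deviation {..<n} X / real n"
     "\<bar>\<integral>y. exp (f y) * (q' y - q y) \<partial>lborel\<bar> \<le> E.deviation {..<n} Y / real n"
     if [measurable]: "f \<in> borel_measurable borel" and f: "\<And>y. \<bar>f y\<bar> \<le> h y" for f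
  proof -
    have f': "- h y \<le> f y" "f y \<le> h y" for y using f[of y] by linarith+
    show "\<bar>\<integral>y. f y * (p' y - p y) \<partial>lborel\<bar> \<le> F.deviation {..<n} X / real n"
      unfolding defs by (rule F.integral_diff_le_deviation[OF n X]) (use f' in auto)
    show "\<bar>\<integral>y. exp (f y) * (q' y - q y) \<partial>lborel\<bar> \<le> E.deviation {..<n} Y / real n"
      unfolding defs by (rule E.integral_diff_le_deviation[OF n Y]) (use f' in auto)
  qed
  have swap: "(\<integral>y. f y * (g y - g' y) \<partial>lborel) = - (\<integral>y. f y * (g' y - g y) \<partial>lborel)" for f g g' :: "'a \<Rightarrow> real"
    by (subst Bochner_Integration.integral_minus[symmetric]) (simp add: algebra_simps)
  have 1: "(\<integral>y. p' y * ln (p' y / q' y) \<partial>lborel) - (\<integral>y. p y * ln (p y / q y) \<partial>lborel)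
      \<le> (F.deviation {..<n} X + E.deviation {..<n} Y) / real n"
    using KL_diff_le[OF meas pq(1,2) pq'(1,2) pq(3) pq'(3) int mass]
      dev[of "\<lambda>y. ln (p' y / q' y)"] pq'(3) unfolding h_def add_divide_distrib by fastforce
  have 2: "(\<integral>y. p y * ln (p y / q y) \<partial>lborel) - (\<integral>y. p' y * ln (p' y / q' y) \<partial>lborel)
      \<le> (F.deviation {..<n} X + E.deviation {..<n} Y) / real n"
    using KL_diff_le[OF meas(3,4,1,2) pq'(1,2) pq(1,2) pq'(3) pq(3) int(3,4,1,2) mass[symmetric],
          unfolded swap[of _ p p'] swap[of _ q q']]
      dev[of "\<lambda>y. ln (p y / q y)"] pq(3) unfolding h_def add_divide_distrib by fastforce
  show ?thesis
    using 1 2 KL_lborel_eq(2)[OF meas(1,2) pq int(1)] KL_lborel_eq(2)[OF meas(3,4) pq' int(3)]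
    by (simp add: defs abs_le_iff)
qed

section \<open>Tail bound for the divergence error\<close>

lemma outer_measure_of_le_emeasure:
  assumes "A \<subseteq> B" "B \<in> sets M"
  shows "outer_measure_of M A \<le> emeasure M B"
  using outer_measure_of_mono[OF assms(1), of M] outer_measure_of_eq[OF assms(2)] by simp

theorem theorem2:
  fixes \<sigma> r z :: real and n :: nat and \<mu> \<nu> :: "'a::euclidean_space measure"
  assumes "\<sigma> > 0" and "r \<ge> 0" and "n \<ge> 1" and "z \<ge> 0"
    and "\<mu> \<in> prob_ball r" and "\<nu> \<in> prob_ball r"
  shows "outer_measure_of (PiM {..<n} (\<lambda>_. \<mu>) \<Otimes>\<^sub>M PiM {..<n} (\<lambda>_. \<nu>))
           {(X, Y) \<in> space (PiM {..<n} (\<lambda>_. \<mu>) \<Otimes>\<^sub>M PiM {..<n} (\<lambda>_. \<nu>)).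
              \<bar>KL_lborel (smooth_dens \<sigma> (empirical n X)) (smooth_dens \<sigma> (empirical n Y))
               - KL_lborel (smooth_dens \<sigma> \<mu>) (smooth_dens \<sigma> \<nu>)\<bar>
              \<ge> ereal (7 / real n) *
                  (rad_avg n (F_class \<sigma> (b_const r \<sigma>)) X + rad_avg n (E_class \<sigma> (b_const r \<sigma>)) Y)
                + ereal (44 * xi_const r (real DIM('a)) \<sigma> * z)}
         \<le> ennreal (2 * exp (- min (real n * z\<^sup>2) (real n * z)))"
    (is "outer_measure_of (?P \<Otimes>\<^sub>M ?Q) ?bad \<le> _")
proof -
  define h where "h = (log_ratio_bound r \<sigma> :: 'a \<Rightarrow> real)"
  define \<xi> where "\<xi> = xi_const r (real DIM('a)) \<sigma>"
  have xi: "\<xi> > 0" by (simp add: \<xi>_def xi_const_def)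
  have h0: "0 \<le> h y" for y using log_ratio_bound_nonneg[OF assms(2)] by (simp add: h_def)
  have h_meas [measurable]: "h \<in> borel_measurable borel" unfolding h_def by measurable
  have he: "h y \<le> exp (h y)" for y using exp_ge_add_one_self[of "h y"] by linarith
  have F: "gauss_sample \<mu> \<sigma> r (\<lambda>y. - h y) h"
    by (rule gauss_sampleI) (use assms h0 he in \<open>auto simp: h_def[symmetric] intro: order_trans\<close>)
  have E: "gauss_sample \<nu> \<sigma> r (\<lambda>y. exp (- h y)) (\<lambda>y. exp (h y))"
    by (rule gauss_sampleI) (use assms h0 in \<open>auto simp: h_def[symmetric] intro: order_trans\<close>)
  interpret F: gauss_sample \<mu> \<sigma> r "\<lambda>y. - h y" h by (rule F)
  interpret E: gauss_sample \<nu> \<sigma> r "\<lambda>y. exp (- h y)" "\<lambda>y. exp (h y)" by (rule E)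
  interpret P: prob_space ?P by (intro prob_space_PiM F.prob_space_axioms)
  interpret Q: prob_space ?Q by (intro prob_space_PiM E.prob_space_axioms)
  interpret PQ: pair_prob_space ?P ?Q ..
  define \<Phi> where "\<Phi> X = F.deviation {..<n} X - 2 * F.rademacher {..<n} X" for X :: "nat \<Rightarrow> 'a"
  define \<Psi> where "\<Psi> Y = E.deviation {..<n} Y - 2 * E.rademacher {..<n} Y" for Y :: "nat \<Rightarrow> 'a"
  have [measurable]: "\<Phi> \<in> borel_measurable ?P" "\<Psi> \<in> borel_measurable ?Q"
    unfolding \<Phi>_def \<Psi>_def by measurable
  define t where "t = 44 * \<xi> * z * real n"
  have large: "t \<le> \<Phi> X + \<Psi> Y"
    if bad: "(X, Y) \<in> ?bad" and X: "\<forall>i<n. norm (X i) \<le> r" and Y: "\<forall>i<n. norm (Y i) \<le> r" for X Y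
  proof -
    have XY: "X \<in> space ?P" "Y \<in> space ?Q" using bad by (auto simp: space_pair_measure)
    have rF: "0 \<le> F.rademacher {..<n} X" and rE: "0 \<le> E.rademacher {..<n} Y"
      using F.rademacher_bounds(1)[OF finite_lessThan XY(1)] E.rademacher_bounds(1)[OF finite_lessThan XY(2)] .
    have RF: "ereal (F.rademacher {..<n} X) \<le> rad_avg n (F_class \<sigma> (b_const r \<sigma>)) X"
    proof (rule F.rademacher_le_rad_avg[OF assms(3) X])
      fix k :: "'a \<Rightarrow> real" assume k: "k \<in> borel_measurable borel" "\<And>y. - h y \<le> k y" "\<And>y. k y \<le> h y"
      have "\<bar>k y\<bar> \<le> h y" for y using k(2,3)[of y] by linarith
      then have "admissible (b_const r \<sigma>) k" using k(1) by (simp add: admissible_iff h_def)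
      then show "conv_gauss \<sigma> k \<in> F_class \<sigma> (b_const r \<sigma>)" by (auto simp: F_class_def)
    qed
    have RE: "ereal (E.rademacher {..<n} Y) \<le> rad_avg n (E_class \<sigma> (b_const r \<sigma>)) Y"
    proof (rule E.rademacher_le_rad_avg[OF assms(3) Y])
      fix k :: "'a \<Rightarrow> real" assume k: "k \<in> borel_measurable borel" "\<And>y. exp (- h y) \<le> k y" "\<And>y. k y \<le> exp (h y)"
      \<comment> \<open>A function in the exponential band is positive, so it equals
        \<open>exp f\<close> with \<open>f = ln k\<close> admissible.\<close>
      have pos: "0 < k y" for y using k(2)[of y] exp_gt_zero[of "- h y"] by linarith
      have "\<bar>ln (k y)\<bar> \<le> h y" for y
        using k(2,3)[of y] pos[of y] ln_ge_iff[of "k y" "- h y"] ln_le_cancel_iff[of "k y" "exp (h y)"] by (simp add: abs_le_iff)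
      then have "admissible (b_const r \<sigma>) (\<lambda>y. ln (k y))" using k(1) by (simp add: admissible_iff h_def)
      moreover have "conv_gauss \<sigma> k = conv_gauss \<sigma> (\<lambda>y. exp (ln (k y)))" using pos by simp
      ultimately show "conv_gauss \<sigma> k \<in> E_class \<sigma> (b_const r \<sigma>)"
        unfolding E_class_def mem_Collect_eq by (intro exI conjI)
    qed
    have "ereal (7 / real n * (F.rademacher {..<n} X + E.rademacher {..<n} Y) + 44 * \<xi> * z)
        = ereal (7 / real n) * (ereal (F.rademacher {..<n} X) + ereal (E.rademacher {..<n} Y)) + ereal (44 * \<xi> * z)"
      by simp
    also have "\<dots> \<le> ereal (7 / real n) * (rad_avg n (F_class \<sigma> (b_const r \<sigma>)) X + rad_avg n (E_class \<sigma> (b_const r \<sigma>)) Y) + ereal (44 * \<xi> * z)"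
      by (intro add_right_mono ereal_mult_left_mono add_mono RF RE) simp
    also have "\<dots> \<le> \<bar>KL_lborel (smooth_dens \<sigma> (empirical n X)) (smooth_dens \<sigma> (empirical n Y))
               - KL_lborel (smooth_dens \<sigma> \<mu>) (smooth_dens \<sigma> \<nu>)\<bar>"
      using bad by (simp add: \<xi>_def)
    also have "\<dots> \<le> ereal ((F.deviation {..<n} X + E.deviation {..<n} Y) / real n)"
      using KL_diff_le_deviation[OF F[unfolded h_def] E[unfolded h_def] assms(3) X Y] by (simp add: h_def)
    finally have "7 / real n * (F.rademacher {..<n} X + E.rademacher {..<n} Y) + 44 * \<xi> * z
        \<le> (F.deviation {..<n} X + E.deviation {..<n} Y) / real n" by simp
    then have "(7 / real n * (F.rademacher {..<n} X + E.rademacher {..<n} Y) + 44 * \<xi> * z) * real n \<le> F.deviation {..<n} X + E.deviation {..<n} Y"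
      using assms(3) by (simp only: pos_le_divide_eq of_nat_0_less_iff)
    moreover have "(7 / real n * (F.rademacher {..<n} X + E.rademacher {..<n} Y) + 44 * \<xi> * z) * real n = 7 * (F.rademacher {..<n} X + E.rademacher {..<n} Y) + t"
      using assms(3) by (simp add: t_def field_simps)
    ultimately have "7 * (F.rademacher {..<n} X + E.rademacher {..<n} Y) + t \<le> F.deviation {..<n} X + E.deviation {..<n} Y"
      by linarith
    \<comment> \<open>\<open>\<Phi>\<close> and \<open>\<Psi>\<close> subtract only twice the
      Rademacher averages; the surplus up to the factor 7 is discarded since the averages are
      nonnegative.\<close>
    then show ?thesis using rF rE by (simp add: \<Phi>_def \<Psi>_def)
  qed
  show ?thesis
  \<comment> \<open>At \<open>z = 0\<close> the claimed bound is 2, while the Chernoff parameter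
    below must be positive.\<close>
  proof (cases "z = 0")
    case True
    have "?bad \<subseteq> space (?P \<Otimes>\<^sub>M ?Q)" by auto
    then have "outer_measure_of (?P \<Otimes>\<^sub>M ?Q) ?bad \<le> emeasure (?P \<Otimes>\<^sub>M ?Q) (space (?P \<Otimes>\<^sub>M ?Q))"
      by (rule outer_measure_of_le_emeasure) (rule sets.top)
    also have "\<dots> \<le> ennreal (2 * exp (- min (real n * z\<^sup>2) (real n * z)))"
      using True by (simp add: PQ.emeasure_space_1)
    finally show ?thesis .
  next
    case False
    then have z: "z > 0" using assms(4) by simp
    \<comment> \<open>The exact minimizer would be \<open>11 * z / (72 * \<xi>)\<close>; this nearby
      value keeps the arithmetic simple.\<close>
    define l where "l = z / (6 * \<xi>)"
    have l: "l > 0" using z xi by (simp add: l_def)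
    \<comment> \<open>A measurable superset of the bad event. The implication admits all samples
      leaving the ball, where nothing is claimed; they form a null set.\<close>
    define A where "A = {w \<in> space (?P \<Otimes>\<^sub>M ?Q). (\<forall>i<n. norm (fst w i) \<le> r \<and> norm (snd w i) \<le> r) \<longrightarrow> t \<le> \<Phi> (fst w) + \<Psi> (snd w)}"
    have A_sets: "A \<in> sets (?P \<Otimes>\<^sub>M ?Q)" unfolding A_def by measurable
    have "?bad \<subseteq> A" using large unfolding A_def by fastforce
    then have "outer_measure_of (?P \<Otimes>\<^sub>M ?Q) ?bad \<le> emeasure (?P \<Otimes>\<^sub>M ?Q) A"
      using A_sets by (rule outer_measure_of_le_emeasure)
    also have "\<dots> \<le> emeasure (?P \<Otimes>\<^sub>M ?Q) {w \<in> space (?P \<Otimes>\<^sub>M ?Q). 1 \<le> ennreal (exp (- l * t)) * ennreal (exp (l * (\<Phi> (fst w) + \<Psi> (snd w))))}"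
    proof (rule emeasure_mono_AE)
      have ae: "AE X in PiM {..<n} (\<lambda>_. \<rho>). \<forall>i<n. norm (X i) \<le> r" if "\<rho> \<in> prob_ball r" for \<rho> :: "'a measure"
      proof -
        have "AE X in PiM {..<n} (\<lambda>_. \<rho>). norm (X i) \<le> r" if "i < n" for i
          using that prob_ballD[OF \<open>\<rho> \<in> prob_ball r\<close>] by (intro AE_PiM_component[where P = "\<lambda>x. norm x \<le> r"]) auto
        then have "AE X in PiM {..<n} (\<lambda>_. \<rho>). \<forall>i\<in>{..<n}. norm (X i) \<le> r"
          by (intro AE_finite_allI) auto
        then show ?thesis by (simp only: Ball_def lessThan_iff)
      qed
      have "AE w in ?P \<Otimes>\<^sub>M ?Q. \<forall>i<n. norm (fst w i) \<le> r \<and> norm (snd w i) \<le> r"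
      proof (rule PQ.AE_pair_measure)
        show "{w \<in> space (?P \<Otimes>\<^sub>M ?Q). \<forall>i<n. norm (fst w i) \<le> r \<and> norm (snd w i) \<le> r} \<in> sets (?P \<Otimes>\<^sub>M ?Q)"
          by measurable
        show "AE X in ?P. AE Y in ?Q. \<forall>i<n. norm (fst (X, Y) i) \<le> r \<and> norm (snd (X, Y) i) \<le> r"
          using ae[OF assms(5)]
        proof (rule eventually_mono)
          fix X :: "nat \<Rightarrow> 'a" assume "\<forall>i<n. norm (X i) \<le> r"
          then show "AE Y in ?Q. \<forall>i<n. norm (fst (X, Y) i) \<le> r \<and> norm (snd (X, Y) i) \<le> r"
            using ae[OF assms(6)] by simp
        qed
      qed
      then show "AE w in ?P \<Otimes>\<^sub>M ?Q. w \<in> A \<longrightarrow> w \<in> {w \<in> space (?P \<Otimes>\<^sub>M ?Q). 1 \<le> ennreal (exp (- l * t)) * ennreal (exp (l * (\<Phi> (fst w) + \<Psi> (snd w))))}"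
      proof (rule eventually_mono)
        fix w :: "(nat \<Rightarrow> 'a) \<times> (nat \<Rightarrow> 'a)"
        assume b: "\<forall>i<n. norm (fst w i) \<le> r \<and> norm (snd w i) \<le> r"
        show "w \<in> A \<longrightarrow> w \<in> {w \<in> space (?P \<Otimes>\<^sub>M ?Q). 1 \<le> ennreal (exp (- l * t)) * ennreal (exp (l * (\<Phi> (fst w) + \<Psi> (snd w))))}"
        proof
          assume "w \<in> A"
          then have w: "w \<in> space (?P \<Otimes>\<^sub>M ?Q)" "t \<le> \<Phi> (fst w) + \<Psi> (snd w)" using b by (auto simp: A_def)
          then have "l * t \<le> l * (\<Phi> (fst w) + \<Psi> (snd w))" using l by (intro mult_left_mono) auto
          then have "1 \<le> exp (- l * t) * exp (l * (\<Phi> (fst w) + \<Psi> (snd w)))"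
            unfolding exp_add[symmetric] by simp
          then show "w \<in> {w \<in> space (?P \<Otimes>\<^sub>M ?Q). 1 \<le> ennreal (exp (- l * t)) * ennreal (exp (l * (\<Phi> (fst w) + \<Psi> (snd w))))}"
            using w(1) by (simp flip: ennreal_mult)
        qed
      qed
    qed measurable
    also have "\<dots> \<le> ennreal (exp (- l * t)) * (\<integral>\<^sup>+w. ennreal (exp (l * (\<Phi> (fst w) + \<Psi> (snd w)))) * indicator (space (?P \<Otimes>\<^sub>M ?Q)) w \<partial>(?P \<Otimes>\<^sub>M ?Q))"
      by (rule nn_integral_Markov_inequality) measurable
    also have "(\<integral>\<^sup>+w. ennreal (exp (l * (\<Phi> (fst w) + \<Psi> (snd w)))) * indicator (space (?P \<Otimes>\<^sub>M ?Q)) w \<partial>(?P \<Otimes>\<^sub>M ?Q))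
        = (\<integral>\<^sup>+w. ennreal (exp (l * \<Phi> (fst w))) * ennreal (exp (l * \<Psi> (snd w))) \<partial>(?P \<Otimes>\<^sub>M ?Q))"
      by (intro nn_integral_cong) (simp add: distrib_left exp_add ennreal_mult)
    \<comment> \<open>Independence of the two samples: the exponential moment of the sum factorizes
      over the product measure.\<close>
    also have "\<dots> = (\<integral>\<^sup>+X. \<integral>\<^sup>+Y. ennreal (exp (l * \<Phi> X)) * ennreal (exp (l * \<Psi> Y)) \<partial>?Q \<partial>?P)"
      by (subst Q.nn_integral_fst[symmetric]) simp_all
    also have "\<dots> = (\<integral>\<^sup>+X. ennreal (exp (l * \<Phi> X)) \<partial>?P) * (\<integral>\<^sup>+Y. ennreal (exp (l * \<Psi> Y)) \<partial>?Q)"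
      by (simp add: nn_integral_cmult nn_integral_multc)
    also have "ennreal (exp (- l * t)) * \<dots> \<le> ennreal (exp (- l * t)) *
        (ennreal (exp (18 * real n * l\<^sup>2 * (2 * \<xi>)\<^sup>2)) * ennreal (exp (18 * real n * l\<^sup>2 * (2 * \<xi>)\<^sup>2)))"
      using F.mgf_deviation_minus_rademacher[OF finite_lessThan[of n] l] E.mgf_deviation_minus_rademacher[OF finite_lessThan[of n] l]
      unfolding \<Phi>_def \<Psi>_def by (intro mult_left_mono mult_mono) (auto simp: \<xi>_def)
    also have "\<dots> = ennreal (exp (- l * t + 36 * real n * l\<^sup>2 * (2 * \<xi>)\<^sup>2))"
      by (simp flip: ennreal_mult exp_add)
    also have "- l * t + 36 * real n * l\<^sup>2 * (2 * \<xi>)\<^sup>2 = - (10 / 3) * (real n * z\<^sup>2)"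
      using xi by (simp add: l_def t_def power2_eq_square)
    \<comment> \<open>The exponent is quadratic for all \<open>z\<close>, and the minimum is at most
      \<open>n * z^2\<close>.\<close>
    also have "ennreal (exp \<dots>) \<le> ennreal (2 * exp (- min (real n * z\<^sup>2) (real n * z)))"
    proof (rule ennreal_leI)
      have "0 \<le> real n * z\<^sup>2" by simp
      then have "- (10 / 3) * (real n * z\<^sup>2) \<le> - min (real n * z\<^sup>2) (real n * z)" by linarith
      then have "exp (- (10 / 3) * (real n * z\<^sup>2)) \<le> exp (- min (real n * z\<^sup>2) (real n * z))" by simp
      then show "exp (- (10 / 3) * (real n * z\<^sup>2)) \<le> 2 * exp (- min (real n * z\<^sup>2) (real n * z))"
        using exp_gt_zero[of "- min (real n * z\<^sup>2) (real n * z)"] by linarith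
    qed
    finally show ?thesis .
  qed
qed

end
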